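(* Let $G$ be a graph on $n$ vertices and let $\mathcal{N} = \{S_{j,j'}\}_{j \in [w], j'}$ be a well-separated clustering of $G$ with width $w$ and separation $h_{\mathrm{sep}}$ such that $|S_{j,j'}| \leq \frac{n}{k'}$ for every cluster. Let $c, c' \in (0,1)$ and $k \in \mathbb{N}$ be such that $k' \geq \frac{wk}{c(1-c')}$. Then there is an algorithm which, in time $O(gn)$, decomposes $\mathcal{N}$ into $g$ groups $\mathcal{G} = \{B_{j,i'}\}_{j \in [g], i' \in [k]}$, each consisting of $k$ blocks, such that: every group has separation $h_{\mathrm{sep}}$; $|B_{j,i'}| = \lceil \frac{cn}{wk} - \frac{n}{k'}\rceil \geq 1$ for all $j, i'$; $g \leq \frac{w}{c}$; $\mathrm{load}_{\mathcal{G}} \leq \mathrm{load}_{\mathcal{N}}$; and at most $\left(2c + \frac{1}{c'k'} + \frac{\mathrm{load}_{\mathcal{G}}\, w k}{c k'}\right) n$ vertices are not contained in any block of $\mathcal{G}$.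
   Context: Distances are shortest-path (hop) distances in $G$; the distance between two vertex sets is the minimum distance between a vertex of one and a vertex of the other. A clustering is a collection of mutually disjoint vertex sets (clusters); it has separation $h_{\mathrm{sep}}$ if any two of its clusters are at distance at least $h_{\mathrm{sep}}$. A well-separated clustering $\mathcal{N}$ of width $w$ is a collection of $w$ clusterings $\mathcal{S}_1,\dots,\mathcal{S}_w$ (the cluster $S_{j,j'}$ being the $j'$-th cluster of $\mathcal{S}_j$) such that every vertex lies in some cluster; it has separation $h_{\mathrm{sep}}$ if each of its clusterings does. $\mathrm{load}_{\mathcal{N}}$ is the maximum number of clusters of $\mathcal{N}$ containing any single vertex. A group is a collection of mutually disjoint vertex sets (blocks); it has separation $h_{\mathrm{sep}}$ if any two of its blocks are at distance at least $h_{\mathrm{sep}}$. For a collection $\mathcal{G}$ of groups, $\mathrm{load}_{\mathcal{G}}$ is the maximum number of blocks of $\mathcal{G}$ containing any single vertex. *)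

theory Defs
  imports "Graph_Theory.Shortest_Path" "Graph_Theory.Pair_Digraph" "HOL-Library.Disjoint_Sets"
begin

section \<open>Distances, clusterings and groups\<close>

text \<open>
  A finite simple undirected graph is a symmetric, loop-free pair digraph (\<^const>\<open>pair_graph\<close>).
  The hop distance is the shortest-path distance for unit arc weights; it is \<open>\<infinity>\<close> between
  different components.
\<close>

definition hop_dist :: "'a pair_pre_digraph \<Rightarrow> 'a \<Rightarrow> 'a \<Rightarrow> ereal" where
  "hop_dist G u v = wf_digraph.\<mu> (with_proj G) (\<lambda>_. 1) u v"

definition set_dist :: "'a pair_pre_digraph \<Rightarrow> 'a set \<Rightarrow> 'a set \<Rightarrow> ereal" where
  "set_dist G A B = (INF u\<in>A. INF v\<in>B. hop_dist G u v)"

text \<open>Clusterings (of clusters) and groups (of blocks) are the same kind of object.\<close>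

definition disjoint_collection :: "'a pair_pre_digraph \<Rightarrow> 'a set set \<Rightarrow> bool" where
  "disjoint_collection G \<S> \<longleftrightarrow> (\<forall>S\<in>\<S>. S \<subseteq> pverts G) \<and> disjoint \<S>"

definition separated :: "'a pair_pre_digraph \<Rightarrow> real \<Rightarrow> 'a set set \<Rightarrow> bool" where
  "separated G h \<S> \<longleftrightarrow> (\<forall>A\<in>\<S>. \<forall>B\<in>\<S>. A \<noteq> B \<longrightarrow> ereal h \<le> set_dist G A B)"

text \<open>
  Collections of clusterings (or groups) are lists, so that a vertex set occurring in two of the
  clusterings counts as two clusters.
\<close>

definition well_separated_clustering ::
    "'a pair_pre_digraph \<Rightarrow> nat \<Rightarrow> real \<Rightarrow> 'a set set list \<Rightarrow> bool" where
  "well_separated_clustering G w h \<N> \<longleftrightarrow>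
     length \<N> = w \<and>
     (\<forall>\<S>\<in>set \<N>. disjoint_collection G \<S> \<and> separated G h \<S>) \<and>
     (\<forall>v\<in>pverts G. \<exists>\<S>\<in>set \<N>. \<exists>S\<in>\<S>. v \<in> S)"

definition load :: "'a pair_pre_digraph \<Rightarrow> 'a set set list \<Rightarrow> nat" where
  "load G \<N> = Max ((\<lambda>v. \<Sum>\<S>\<leftarrow>\<N>. card {S\<in>\<S>. v \<in> S}) ` pverts G)"

definition uncovered :: "'a pair_pre_digraph \<Rightarrow> 'a set set list \<Rightarrow> 'a set" where
  "uncovered G \<G> = {v \<in> pverts G. \<not> (\<exists>\<B>\<in>set \<G>. \<exists>B\<in>\<B>. v \<in> B)}"

text \<open>
  \<open>\<G>\<close> decomposes \<open>\<N>\<close>: each group is carved out of the clusters of a single clustering, and different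
  groups use different vertices of that clustering. Vertices may be left over.
\<close>

definition decomposes_into :: "'a set set list \<Rightarrow> 'a set set list \<Rightarrow> bool" where
  "decomposes_into \<N> \<G> \<longleftrightarrow>
     (\<exists>\<sigma>. (\<forall>j<length \<G>. \<sigma> j < length \<N> \<and> \<Union>(\<G> ! j) \<subseteq> \<Union>(\<N> ! \<sigma> j)) \<and>
          (\<forall>i<length \<G>. \<forall>j<length \<G>. i \<noteq> j \<and> \<sigma> i = \<sigma> j \<longrightarrow> \<Union>(\<G> ! i) \<inter> \<Union>(\<G> ! j) = {}))"

section \<open>Random access machine programs with running time\<close>

text \<open>
  Memory consists of finitely many (per program) arrays of natural numbers with indirect
  addressing; the scalar \<open>x\<close> is cell 0 of the array \<open>x\<close>. The only arithmetic on memory contents is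
  addition and truncated subtraction, so unit cost per operation is reasonable. Real input
  parameters (here \<open>c\<close>, \<open>c'\<close> and \<open>k'\<close>) are read-only and are used, as on a real RAM, only in
  comparisons of arithmetic expressions; there is no rounding operation.
\<close>

type_synonym name = string
type_synonym mem = "name \<Rightarrow> nat \<Rightarrow> nat"
type_synonym params = "name \<Rightarrow> real"

datatype nexp = Num nat | Get name nexp | Plus nexp nexp | Minus nexp nexp

datatype rexp = Par name | Cast nexp | RAdd rexp rexp | RSub rexp rexp | RMul rexp rexp | RDiv rexp rexp

datatype bexp = NLess nexp nexp | RLess rexp rexp | Neg bexp | Conj bexp bexp

datatype com = Skip | Put name nexp nexp | Seq com com | Cond bexp com com | While bexp com

fun nval :: "mem \<Rightarrow> nexp \<Rightarrow> nat" where
  "nval m (Num i) = i"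
| "nval m (Get x e) = m x (nval m e)"
| "nval m (Plus e f) = nval m e + nval m f"
| "nval m (Minus e f) = nval m e - nval m f"

fun rval :: "params \<Rightarrow> mem \<Rightarrow> rexp \<Rightarrow> real" where
  "rval \<rho> m (Par x) = \<rho> x"
| "rval \<rho> m (Cast e) = real (nval m e)"
| "rval \<rho> m (RAdd e f) = rval \<rho> m e + rval \<rho> m f"
| "rval \<rho> m (RSub e f) = rval \<rho> m e - rval \<rho> m f"
| "rval \<rho> m (RMul e f) = rval \<rho> m e * rval \<rho> m f"
| "rval \<rho> m (RDiv e f) = rval \<rho> m e / rval \<rho> m f"

fun bval :: "params \<Rightarrow> mem \<Rightarrow> bexp \<Rightarrow> bool" where
  "bval \<rho> m (NLess e f) \<longleftrightarrow> nval m e < nval m f"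
| "bval \<rho> m (RLess e f) \<longleftrightarrow> rval \<rho> m e < rval \<rho> m f"
| "bval \<rho> m (Neg b) \<longleftrightarrow> \<not> bval \<rho> m b"
| "bval \<rho> m (Conj a b) \<longleftrightarrow> bval \<rho> m a \<and> bval \<rho> m b"

text \<open>
  \<open>exec \<rho> p m t m'\<close>: started in memory \<open>m\<close>, the program \<open>p\<close> halts after \<open>t\<close> steps in memory \<open>m'\<close>.
  The expressions in a program have fixed size, so counting their individual operations instead of
  one step per command and test would change \<open>t\<close> only by a factor depending on the program.
\<close>

inductive exec :: "params \<Rightarrow> com \<Rightarrow> mem \<Rightarrow> nat \<Rightarrow> mem \<Rightarrow> bool" for \<rho> :: params where
  Skip: "exec \<rho> Skip m 1 m"
| Put: "exec \<rho> (Put x i e) m 1 (m(x := (m x)(nval m i := nval m e)))"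
| Seq: "exec \<rho> p m t m' \<Longrightarrow> exec \<rho> q m' t' m'' \<Longrightarrow> exec \<rho> (Seq p q) m (t + t') m''"
| CondTrue: "bval \<rho> m b \<Longrightarrow> exec \<rho> p m t m' \<Longrightarrow> exec \<rho> (Cond b p q) m (1 + t) m'"
| CondFalse: "\<not> bval \<rho> m b \<Longrightarrow> exec \<rho> q m t m' \<Longrightarrow> exec \<rho> (Cond b p q) m (1 + t) m'"
| WhileFalse: "\<not> bval \<rho> m b \<Longrightarrow> exec \<rho> (While b p) m 1 m"
| WhileTrue: "bval \<rho> m b \<Longrightarrow> exec \<rho> p m t m' \<Longrightarrow> exec \<rho> (While b p) m' t' m'' \<Longrightarrow>
    exec \<rho> (While b p) m (1 + t + t') m''"

section \<open>Input and output format\<close>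

text \<open>
  Vertices are numbers. A collection of clusterings (or groups) is presented by listing its
  clusterings in order, each cluster of a clustering once, and each vertex of a cluster once, in any
  order. Nested lists are stored consecutively, each preceded by its length. The algorithm operates on
  the clustering and the parameters only; the edges of the graph are not part of its input.
\<close>

definition represents :: "nat list list list \<Rightarrow> nat set set list \<Rightarrow> bool" where
  "represents L \<N> \<longleftrightarrow>
     \<N> = map (\<lambda>X. set ` set X) L \<and>
     (\<forall>X\<in>set L. distinct (map set X) \<and> (\<forall>x\<in>set X. distinct x))"

definition encode_cluster :: "nat list \<Rightarrow> nat list" where
  "encode_cluster x = length x # x"

definition encode_clustering :: "nat list list \<Rightarrow> nat list" where
  "encode_clustering X = length X # concat (map encode_cluster X)"

definition encode :: "nat list list list \<Rightarrow> nat list" where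
  "encode L = length L # concat (map encode_clustering L)"

text \<open>All memory not used for the input is initially 0.\<close>

definition initial_mem :: "nat \<Rightarrow> nat \<Rightarrow> nat list list list \<Rightarrow> mem" where
  "initial_mem n k L = (\<lambda>_ _. 0)
     (''n'' := (\<lambda>_. 0)(0 := n),
      ''k'' := (\<lambda>_. 0)(0 := k),
      ''in'' := (\<lambda>i. if i < length (encode L) then encode L ! i else 0))"

definition initial_params :: "real \<Rightarrow> real \<Rightarrow> real \<Rightarrow> params" where
  "initial_params c c' k' = (\<lambda>_. 0)(''c'' := c, ''c1'' := c', ''k1'' := k')"

definition writes_output :: "mem \<Rightarrow> nat list list list \<Rightarrow> bool" where
  "writes_output m L \<longleftrightarrow> (\<forall>i<length (encode L). m ''out'' i = encode L ! i)"

end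

theory Submission
  imports Defs
begin

text \<open>
  Write \<open>A = cn/(wk)\<close>, \<open>D = n/k'\<close>, \<open>s = \<lceil>A - D\<rceil>\<close> and \<open>T = \<lfloor>A\<rfloor>\<close>. The clusterings are processed in order. The
  vertices of the current clustering that lie in no earlier block are listed cluster by cluster, and
  blocks of \<open>s\<close> consecutive entries are cut out at stride \<open>T\<close>. As clusters have at most
  \<open>\<lfloor>D\<rfloor> \<le> T - s + 1\<close> vertices, no cluster meets two blocks, so every \<open>k\<close> consecutive blocks form a group
  with the separation of the clustering. The algorithm stops creating groups once there are
  \<open>\<lfloor>w/c\<rfloor>\<close> of them. All blocks are disjoint, so the load is 1.

  If the cap \<open>\<lfloor>w/c\<rfloor>\<close> is not reached, a clustering leaves fewer than \<open>kT \<le> cn/w\<close> unused entries and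
  each group wastes \<open>k(T - s) \<le> kD\<close>, so at most \<open>cn + (w/c)kD\<close> vertices are uncovered; if the cap is
  reached, the \<open>gks\<close> covered vertices suffice for the same bound.

  The running time is linear in the lengths of input and output. The input has length \<open>O(gn)\<close>: below
  the cap, a clustering with \<open>g\<^sub>j\<close> groups of its own has at most \<open>gks + (g\<^sub>j + 1)kT\<close> vertices in its
  clusters, and at the cap \<open>w = O(g)\<close>.
\<close>

section \<open>Reasoning about programs with running time\<close>

text \<open>Total correctness with time: the existential includes termination, and \<open>Q\<close>
  sees the number of steps, so running time and result come out of one induction.\<close>

definition wp :: "params \<Rightarrow> com \<Rightarrow> (nat \<Rightarrow> mem \<Rightarrow> bool) \<Rightarrow> mem \<Rightarrow> bool" where
  "wp \<rho> p Q m \<longleftrightarrow> (\<exists>t m'. exec \<rho> p m t m' \<and> Q t m')"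

inductive_cases exec_SkipE: "exec \<rho> Skip m t m'"
inductive_cases exec_PutE: "exec \<rho> (Put x i e) m t m'"
inductive_cases exec_SeqE: "exec \<rho> (Seq p q) m t m'"
inductive_cases exec_CondE: "exec \<rho> (Cond b p q) m t m'"
inductive_cases exec_WhileE: "exec \<rho> (While b p) m t m'"

lemma wp_Skip [simp]: "wp \<rho> Skip Q m \<longleftrightarrow> Q 1 m"
  unfolding wp_def by (auto elim: exec_SkipE) (metis exec.Skip One_nat_def)

lemma wp_Put [simp]:
  "wp \<rho> (Put x i e) Q m \<longleftrightarrow> Q 1 (m(x := (m x)(nval m i := nval m e)))"
  unfolding wp_def by (auto elim: exec_PutE) (metis exec.Put One_nat_def)

lemma wp_Seq [simp]: "wp \<rho> (Seq p q) Q m \<longleftrightarrow> wp \<rho> p (\<lambda>t. wp \<rho> q (\<lambda>t'. Q (t + t'))) m"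
  unfolding wp_def by (blast intro: exec.Seq elim: exec_SeqE)

lemma wp_Cond [simp]:
  "wp \<rho> (Cond b p q) Q m \<longleftrightarrow>
     (if bval \<rho> m b then wp \<rho> p (\<lambda>t. Q (1 + t)) m else wp \<rho> q (\<lambda>t. Q (1 + t)) m)"
  unfolding wp_def by (auto elim!: exec_CondE) (metis exec.CondTrue exec.CondFalse plus_1_eq_Suc)+

text \<open>As a simplification rule this would unfold forever. Each loop is unrolled once with
  \<open>subst\<close>, and the remaining iterations are left to an induction hypothesis.\<close>

lemma wp_While:
  "wp \<rho> (While b p) Q m \<longleftrightarrow>
     (if bval \<rho> m b then wp \<rho> p (\<lambda>t. wp \<rho> (While b p) (\<lambda>t'. Q (1 + t + t'))) m else Q 1 m)"
proof
  assume "wp \<rho> (While b p) Q m"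
  then obtain t m' where ex: "exec \<rho> (While b p) m t m'" and Q: "Q t m'"
    unfolding wp_def by blast
  from ex show "if bval \<rho> m b then wp \<rho> p (\<lambda>t. wp \<rho> (While b p) (\<lambda>t'. Q (1 + t + t'))) m else Q 1 m"
    by (rule exec_WhileE) (use Q in \<open>auto simp: wp_def\<close>)
next
  assume *: "if bval \<rho> m b then wp \<rho> p (\<lambda>t. wp \<rho> (While b p) (\<lambda>t'. Q (1 + t + t'))) m else Q 1 m"
  show "wp \<rho> (While b p) Q m"
  proof (cases "bval \<rho> m b")
    case True
    with * show ?thesis
      unfolding wp_def by (metis exec.WhileTrue)
  next
    case False
    with * exec.WhileFalse [OF False] show ?thesis
      unfolding wp_def by auto
  qed
qed

lemma wp_mono: "wp \<rho> p Q m \<Longrightarrow> (\<And>t m'. Q t m' \<Longrightarrow> Q' t m') \<Longrightarrow> wp \<rho> p Q' m"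
  unfolding wp_def by blast

section \<open>Lists stored in arrays\<close>

primrec seg :: "(nat \<Rightarrow> nat) \<Rightarrow> nat \<Rightarrow> nat list \<Rightarrow> bool" where
  "seg f a [] \<longleftrightarrow> True"
| "seg f a (x # xs) \<longleftrightarrow> f a = x \<and> seg f (Suc a) xs"

lemma seg_append [simp]: "seg f a (xs @ ys) \<longleftrightarrow> seg f a xs \<and> seg f (a + length xs) ys"
  by (induction xs arbitrary: a) auto

lemma seg_upd [simp]: "a + length xs \<le> i \<Longrightarrow> seg (f(i := v)) a xs \<longleftrightarrow> seg f a xs"
  by (induction xs arbitrary: a) auto

lemmas seg_upd_lambda [simp] = seg_upd [unfolded fun_upd_def]

lemma seg_upd_before [simp]: "i < a \<Longrightarrow> seg (f(i := v)) a xs \<longleftrightarrow> seg f a xs"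
  by (induction xs arbitrary: a) auto

lemma seg_iff_nth: "seg f a xs \<longleftrightarrow> (\<forall>i<length xs. f (a + i) = xs ! i)"
proof (induction xs arbitrary: a)
  case (Cons x xs)
  show ?case
    by (auto simp: Cons nth_Cons split: nat.splits)
qed simp

lemma seg_drop: "seg f a xs \<Longrightarrow> seg f (a + i) (drop i xs)"
  by (auto simp: seg_iff_nth add.assoc)

lemma seg_take: "seg f a xs \<Longrightarrow> seg f a (take i xs)"
  by (auto simp: seg_iff_nth)

definition unchanged :: "name set \<Rightarrow> mem \<Rightarrow> mem \<Rightarrow> bool" where
  "unchanged A m m' \<longleftrightarrow> (\<forall>x. x \<notin> A \<longrightarrow> m' x = m x)"

section \<open>The program\<close>

notation Seq (infixr \<open>;;\<close> 60)

abbreviation Var :: "name \<Rightarrow> nexp" where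
  "Var x \<equiv> Get x (Num 0)"

abbreviation assign :: "name \<Rightarrow> nexp \<Rightarrow> com" (infix \<open>::=\<close> 61) where
  "x ::= e \<equiv> Put x (Num 0) e"

text \<open>
  \<open>p\<close> and \<open>o\<close> are the positions in \<open>in\<close> and \<open>out\<close>, where \<open>out\<close> is written from cell 1 because the number
  \<open>g\<close> of groups is known only at the end. \<open>r\<close>, \<open>a\<close>, \<open>b\<close> count the clusterings, clusters and vertices still
  to be read, \<open>i\<close> and \<open>l\<close> the blocks and vertices still to be written. \<open>Y\<close>, of length \<open>y\<close>, lists the
  vertices of the current clustering that are not yet marked as covered; \<open>x\<close> is the start of the next
  block in it and \<open>z\<close> runs through the block.
\<close>

definition read_cluster :: com where
  "read_cluster =
     While (NLess (Num 0) (Var ''b''))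
       (Cond (NLess (Num 0) (Get ''mark'' (Get ''in'' (Var ''p''))))
          Skip
          (Put ''Y'' (Var ''y'') (Get ''in'' (Var ''p'')) ;; ''y'' ::= Plus (Var ''y'') (Num 1)) ;;
        ''p'' ::= Plus (Var ''p'') (Num 1) ;;
        ''b'' ::= Minus (Var ''b'') (Num 1))"

definition read_clustering :: com where
  "read_clustering =
     While (NLess (Num 0) (Var ''a''))
       (''b'' ::= Get ''in'' (Var ''p'') ;;
        ''p'' ::= Plus (Var ''p'') (Num 1) ;;
        read_cluster ;;
        ''a'' ::= Minus (Var ''a'') (Num 1))"

definition write_block :: com where
  "write_block =
     While (NLess (Num 0) (Var ''l''))
       (Put ''out'' (Var ''o'') (Get ''Y'' (Var ''z'')) ;;
        Put ''mark'' (Get ''Y'' (Var ''z'')) (Num 1) ;;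
        ''o'' ::= Plus (Var ''o'') (Num 1) ;;
        ''z'' ::= Plus (Var ''z'') (Num 1) ;;
        ''l'' ::= Minus (Var ''l'') (Num 1))"

definition write_group :: com where
  "write_group =
     While (NLess (Num 0) (Var ''i''))
       (Put ''out'' (Var ''o'') (Var ''s'') ;;
        ''o'' ::= Plus (Var ''o'') (Num 1) ;;
        ''z'' ::= Var ''x'' ;;
        ''l'' ::= Var ''s'' ;;
        write_block ;;
        ''x'' ::= Plus (Var ''x'') (Var ''T'') ;;
        ''i'' ::= Minus (Var ''i'') (Num 1))"

definition write_groups :: com where
  "write_groups =
     While
       (Conj
         (Neg (RLess (Cast (Var ''y''))
                     (RAdd (Cast (Var ''x'')) (RMul (Cast (Var ''k'')) (Cast (Var ''T''))))))
         (Neg (RLess (Cast (Var ''w'')) (RMul (Cast (Plus (Var ''g'') (Num 1))) (Par ''c'')))))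
       (Put ''out'' (Var ''o'') (Var ''k'') ;;
        ''o'' ::= Plus (Var ''o'') (Num 1) ;;
        ''i'' ::= Var ''k'' ;;
        write_group ;;
        ''g'' ::= Plus (Var ''g'') (Num 1))"

definition process_clusterings :: com where
  "process_clusterings =
     While (NLess (Num 0) (Var ''r''))
       (''a'' ::= Get ''in'' (Var ''p'') ;;
        ''p'' ::= Plus (Var ''p'') (Num 1) ;;
        ''y'' ::= Num 0 ;;
        read_clustering ;;
        ''x'' ::= Num 0 ;;
        write_groups ;;
        ''r'' ::= Minus (Var ''r'') (Num 1))"

definition share :: rexp where
  "share = RDiv (RMul (Par ''c'') (Cast (Var ''n'')))
                (RMul (Cast (Var ''w'')) (Cast (Var ''k'')))"

text \<open>The machine cannot round, so the ceiling s is found by counting up, as is the floor T in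
  \<open>compute_stride\<close>.\<close>

definition compute_size :: com where
  "compute_size =
     While (RLess (Cast (Var ''s'')) (RSub share (RDiv (Cast (Var ''n'')) (Par ''k1''))))
       (''s'' ::= Plus (Var ''s'') (Num 1))"

definition compute_stride :: com where
  "compute_stride =
     While (Neg (RLess share (Cast (Plus (Var ''T'') (Num 1)))))
       (''T'' ::= Plus (Var ''T'') (Num 1))"

definition decompose :: com where
  "decompose =
     ''w'' ::= Get ''in'' (Num 0) ;;
     compute_size ;;
     compute_stride ;;
     ''p'' ::= Num 1 ;;
     ''o'' ::= Num 1 ;;
     ''r'' ::= Var ''w'' ;;
     process_clusterings ;;
     Put ''out'' (Num 0) (Var ''g'')"

section \<open>The list function computed by the program\<close>

primrec blocks :: "nat \<Rightarrow> nat \<Rightarrow> nat \<Rightarrow> 'a list \<Rightarrow> 'a list list" where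
  "blocks s T 0 Z = []"
| "blocks s T (Suc i) Z = take s Z # blocks s T i (drop T Z)"

primrec groups :: "nat \<Rightarrow> nat \<Rightarrow> nat \<Rightarrow> nat \<Rightarrow> 'a list \<Rightarrow> 'a list list list" where
  "groups s T k 0 Z = []"
| "groups s T k (Suc q) Z = blocks s T k Z # groups s T k q (drop (k * T) Z)"

definition covered :: "'a list list list \<Rightarrow> 'a set" where
  "covered Ls = set (concat (concat Ls))"

text \<open>The minimum combines the two exit conditions of \<open>write_groups\<close>: the number
  of groups that fit into \<open>Z\<close>, and the number that the cap still permits.\<close>

definition carve_one ::
    "nat \<Rightarrow> nat \<Rightarrow> nat \<Rightarrow> nat \<Rightarrow> 'a list list \<Rightarrow> 'a list list list \<Rightarrow> 'a list list list" where
  "carve_one s T k cap X Ls =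
     (let Z = filter (\<lambda>v. v \<notin> covered Ls) (concat X)
      in groups s T k (min (length Z div (k * T)) (cap - length Ls)) Z)"

primrec carve ::
    "nat \<Rightarrow> nat \<Rightarrow> nat \<Rightarrow> nat \<Rightarrow> 'a list list list \<Rightarrow> 'a list list list \<Rightarrow> 'a list list list" where
  "carve s T k cap [] Ls = []"
| "carve s T k cap (X # L) Ls =
     (let N = carve_one s T k cap X Ls in N @ carve s T k cap L (Ls @ N))"

section \<open>Execution of the program\<close>

text \<open>A vertex costs at most six steps: loop test, branch test, two writes for
  \<open>Y\<close> and two counter updates. The marks enter only through the set \<open>M\<close> of
  marked vertices.\<close>

lemma read_cluster:
  assumes "seg (m ''in'') (m ''p'' 0) xs" "m ''b'' 0 = length xs"
    and "seg (m ''Y'') 0 Y" "m ''y'' 0 = length Y"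
    and "\<forall>v. 0 < m ''mark'' v \<longleftrightarrow> v \<in> M"
  shows "wp \<rho> read_cluster
    (\<lambda>t m'. t \<le> 6 * length xs + 1 \<and> unchanged {''p'', ''b'', ''Y'', ''y''} m m' \<and>
       m' ''p'' 0 = m ''p'' 0 + length xs \<and>
       seg (m' ''Y'') 0 (Y @ filter (\<lambda>v. v \<notin> M) xs) \<and>
       m' ''y'' 0 = length (Y @ filter (\<lambda>v. v \<notin> M) xs)) m"
  using assms
proof (induction xs arbitrary: m Y)
  case Nil
  then show ?case
    unfolding read_cluster_def by (subst wp_While) (simp add: unchanged_def)
next
  case (Cons x xs)
  show ?case
  proof (cases "x \<in> M")
    case True
    with Cons.prems show ?thesis
      unfolding read_cluster_def
      apply (subst wp_While)
      apply (fold read_cluster_def)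
      apply simp
      apply (rule wp_mono [OF Cons.IH [where Y = Y]])
      apply (auto simp: unchanged_def)
      done
  next
    case False
    with Cons.prems show ?thesis
      unfolding read_cluster_def
      apply (subst wp_While)
      apply (fold read_cluster_def)
      apply simp
      apply (rule wp_mono [OF Cons.IH [where Y = "Y @ [x]"]])
      apply (auto simp: unchanged_def)
      done
  qed
qed

text \<open>The five extra steps per cluster are charged to the cell holding its length, so six
  steps per input cell still suffice.\<close>

lemma read_clustering:
  assumes "seg (m ''in'') (m ''p'' 0) (concat (map encode_cluster X))" "m ''a'' 0 = length X"
    and "seg (m ''Y'') 0 Y" "m ''y'' 0 = length Y"
    and "\<forall>v. 0 < m ''mark'' v \<longleftrightarrow> v \<in> M"
  shows "wp \<rho> read_clustering
    (\<lambda>t m'. t \<le> 6 * length (concat (map encode_cluster X)) + 1 \<and>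
       unchanged {''p'', ''a'', ''b'', ''Y'', ''y''} m m' \<and>
       m' ''p'' 0 = m ''p'' 0 + length (concat (map encode_cluster X)) \<and>
       seg (m' ''Y'') 0 (Y @ filter (\<lambda>v. v \<notin> M) (concat X)) \<and>
       m' ''y'' 0 = length (Y @ filter (\<lambda>v. v \<notin> M) (concat X))) m"
  using assms
proof (induction X arbitrary: m Y)
  case Nil
  then show ?case
    unfolding read_clustering_def by (subst wp_While) (simp add: unchanged_def)
next
  case (Cons x X)
  from Cons.prems show ?case
    unfolding read_clustering_def
    apply (subst wp_While)
    apply (fold read_clustering_def)
    apply (simp add: encode_cluster_def [of x])
    apply (rule wp_mono [OF read_cluster [where Y = Y and M = M and xs = x]])
    apply (simp_all)
    apply (rule wp_mono [OF Cons.IH [where Y = "Y @ filter (\<lambda>v. v \<notin> M) x"]])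
    apply (simp_all add: unchanged_def encode_cluster_def [of x])
    done
qed

lemma write_block:
  assumes "seg (m ''Y'') (m ''z'' 0) xs" "m ''l'' 0 = length xs"
    and "seg (m ''out'') 1 W" "m ''o'' 0 = Suc (length W)"
    and "\<forall>v. 0 < m ''mark'' v \<longleftrightarrow> v \<in> M"
  shows "wp \<rho> write_block
    (\<lambda>t m'. t \<le> 6 * length xs + 1 \<and>
       unchanged {''z'', ''l'', ''out'', ''o'', ''mark''} m m' \<and>
       seg (m' ''out'') 1 (W @ xs) \<and>
       m' ''o'' 0 = Suc (length (W @ xs)) \<and>
       (\<forall>v. 0 < m' ''mark'' v \<longleftrightarrow> v \<in> M \<union> set xs)) m"
  using assms
proof (induction xs arbitrary: m W M)
  case Nil
  then show ?case
    unfolding write_block_def by (subst wp_While) (simp add: unchanged_def)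
next
  case (Cons x xs)
  from Cons.prems show ?case
    unfolding write_block_def
    apply (subst wp_While)
    apply (fold write_block_def)
    apply simp
    apply (rule wp_mono [OF Cons.IH [where W = "W @ [x]" and M = "insert x M"]])
    apply (auto simp: unchanged_def)
    done
qed

text \<open>A block costs eight steps besides six per vertex. Charging them to its length cell gives
  the factor 8.\<close>

lemma write_group:
  assumes "seg (m ''Y'') (m ''x'' 0) Z" "m ''i'' 0 = i" "i * T \<le> length Z" "s \<le> T"
    and "m ''s'' 0 = s" "m ''T'' 0 = T"
    and "seg (m ''out'') 1 W" "m ''o'' 0 = Suc (length W)"
    and "\<forall>v. 0 < m ''mark'' v \<longleftrightarrow> v \<in> M"
  shows "wp \<rho> write_group
    (\<lambda>t m'. t \<le> 8 * length (concat (map encode_cluster (blocks s T i Z))) + 1 \<and>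
       unchanged {''x'', ''i'', ''z'', ''l'', ''out'', ''o'', ''mark''} m m' \<and>
       m' ''x'' 0 = m ''x'' 0 + i * T \<and>
       seg (m' ''out'') 1 (W @ concat (map encode_cluster (blocks s T i Z))) \<and>
       m' ''o'' 0 = Suc (length (W @ concat (map encode_cluster (blocks s T i Z)))) \<and>
       (\<forall>v. 0 < m' ''mark'' v \<longleftrightarrow> v \<in> M \<union> set (concat (blocks s T i Z)))) m"
  using assms
proof (induction i arbitrary: m Z W M)
  case 0
  then show ?case
    unfolding write_group_def by (subst wp_While) (simp add: unchanged_def)
next
  case (Suc i)
  from Suc.prems have le: "s \<le> length Z" "i * T \<le> length (drop T Z)"
    by auto
  from seg_drop [OF Suc.prems(1), of T] seg_take [OF Suc.prems(1), of s] Suc.prems(2-) le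
  show ?case
    unfolding write_group_def
    apply (subst wp_While)
    apply (fold write_group_def)
    apply (simp add: encode_cluster_def [of "take s Z"])
    apply (rule wp_mono [OF write_block [where xs = "take s Z" and W = "W @ [s]" and M = M]])
    apply simp_all
    apply (rule wp_mono [OF Suc.IH [where Z = "drop T Z" and W = "W @ s # take s Z"
            and M = "M \<union> set (take s Z)"]])
    apply (simp_all add: unchanged_def encode_cluster_def [of "take s Z"])
    done
qed

lemma length_blocks [simp]: "length (blocks s T k Z) = k"
  by (induction k arbitrary: Z) auto

text \<open>\<open>q\<close> is the number of iterations. The hypothesis \<open>cap\<close> turns
  the real test on \<open>g\<close> into a comparison of natural numbers, so no arithmetic with c
  enters the induction.\<close>

lemma write_groups:
  assumes "seg (m ''Y'') (m ''x'' 0) Z" "m ''y'' 0 = m ''x'' 0 + length Z" "s \<le> T"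
    and "m ''s'' 0 = s" "m ''T'' 0 = T" "m ''k'' 0 = k" "m ''w'' 0 = w" "0 < k * T"
    and cap: "\<And>j. real w < (1 + real j) * \<rho> ''c'' \<longleftrightarrow> cap \<le> j"
    and "q = min (length Z div (k * T)) (cap - m ''g'' 0)"
    and "seg (m ''out'') 1 W" "m ''o'' 0 = Suc (length W)"
    and "\<forall>v. 0 < m ''mark'' v \<longleftrightarrow> v \<in> M"
  shows "wp \<rho> write_groups
    (\<lambda>t m'. t \<le> 8 * length (concat (map encode_clustering (groups s T k q Z))) + 1 \<and>
       unchanged {''g'', ''x'', ''i'', ''z'', ''l'', ''out'', ''o'', ''mark''} m m' \<and>
       m' ''g'' 0 = m ''g'' 0 + q \<and>
       seg (m' ''out'') 1 (W @ concat (map encode_clustering (groups s T k q Z))) \<and>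
       m' ''o'' 0 = Suc (length (W @ concat (map encode_clustering (groups s T k q Z)))) \<and>
       (\<forall>v. 0 < m' ''mark'' v \<longleftrightarrow> v \<in> M \<union> covered (groups s T k q Z))) m"
  using assms(1-8,10-)
proof (induction q arbitrary: m Z W M)
  case 0
  have "length Z < k * T \<or> cap \<le> m ''g'' 0"
    using 0 by (auto simp: min_def div_eq_0_iff split: if_splits)
  with 0 cap have stop: "real (length Z) < real k * real T \<or>
      real w < (1 + real (m ''g'' 0)) * \<rho> ''c''"
    by (auto simp flip: of_nat_mult)
  show ?case unfolding write_groups_def
    by (subst wp_While) (use stop 0(1-8,10-) in \<open>auto simp: unchanged_def covered_def\<close>)
next
  case (Suc q)
  from Suc.prems have le: "k * T \<le> length Z" "m ''g'' 0 < cap"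
  proof -
    have "0 < min (length Z div (k * T)) (cap - m ''g'' 0)"
      using Suc.prems by (metis zero_less_Suc)
    then show "k * T \<le> length Z" "m ''g'' 0 < cap"
      by (simp_all add: div_greater_zero_iff)
  qed
  have test: "\<not> real (m ''y'' 0) < real (m ''x'' 0) + real k * real T"
      "\<not> real w < (1 + real (m ''g'' 0)) * \<rho> ''c''"
    using Suc.prems le cap by (auto simp flip: of_nat_mult of_nat_add)
  \<comment> \<open>One group uses up kT entries and one unit of the cap, so both arguments of the
    minimum drop by one.\<close>
  have q: "min ((length Z - k * T) div (k * T)) (cap - Suc (m ''g'' 0)) = q"
  proof -
    have "length Z div (k * T) = Suc ((length Z - k * T) div (k * T))"
      using Suc.prems(8) le by (simp add: le_div_geq)
    moreover have "cap - m ''g'' 0 = Suc (cap - Suc (m ''g'' 0))"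
      using le by simp
    ultimately show ?thesis
      using Suc.prems(9) by (metis diff_Suc_1 min_Suc_Suc)
  qed
  from seg_drop [OF Suc.prems(1), of "k * T"] Suc.prems(1-8,10-) le test
  show ?case
    unfolding write_groups_def
    apply (subst wp_While)
    apply (fold write_groups_def)
    apply (simp add: encode_clustering_def [of "blocks s T k Z"])
    apply (rule wp_mono [OF write_group [where Z = Z and i = k and s = s and T = T
            and W = "W @ [k]" and M = M]])
    apply simp_all
    apply (rule wp_mono [OF Suc.IH [where Z = "drop (k * T) Z"
            and W = "W @ encode_clustering (blocks s T k Z)"
            and M = "M \<union> set (concat (blocks s T k Z))"]])
    apply (simp_all add: unchanged_def encode_clustering_def [of "blocks s T k Z"] covered_def q)
    done
qed

lemma length_groups [simp]: "length (groups s T k q Z) = q"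
  by (induction q arbitrary: Z) auto

lemma covered_append [simp]: "covered (Ls @ Ls') = covered Ls \<union> covered Ls'"
  by (simp add: covered_def)

text \<open>Invariant: marks and output describe exactly \<open>Ls\<close>. Between clusterings only
  the length \<open>y\<close> is reset; stale cells of \<open>Y\<close> lie beyond the list that
  \<open>seg\<close> describes.\<close>

lemma process_clusterings:
  assumes "seg (m ''in'') (m ''p'' 0) (concat (map encode_clustering L))" "m ''r'' 0 = length L"
    and "s \<le> T" "m ''s'' 0 = s" "m ''T'' 0 = T" "m ''k'' 0 = k" "m ''w'' 0 = w" "0 < k * T"
    and cap: "\<And>j. real w < (1 + real j) * \<rho> ''c'' \<longleftrightarrow> cap \<le> j"
    and "m ''g'' 0 = length Ls"
    and "seg (m ''out'') 1 (concat (map encode_clustering Ls))"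
    and "m ''o'' 0 = Suc (length (concat (map encode_clustering Ls)))"
    and "\<forall>v. 0 < m ''mark'' v \<longleftrightarrow> v \<in> covered Ls"
  shows "wp \<rho> process_clusterings
    (\<lambda>t m'. t \<le> 8 * length (concat (map encode_clustering L)) +
             8 * length (concat (map encode_clustering (carve s T k cap L Ls))) + 1 \<and>
       m' ''g'' 0 = length (Ls @ carve s T k cap L Ls) \<and>
       seg (m' ''out'') 1 (concat (map encode_clustering (Ls @ carve s T k cap L Ls)))) m"
  using assms(1-8,10-)
proof (induction L arbitrary: m Ls)
  case Nil
  then show ?case
    unfolding process_clusterings_def by (subst wp_While) simp
next
  case (Cons X L)
  define Z where "Z = filter (\<lambda>v. v \<notin> covered Ls) (concat X)"
  define q where "q = min (length Z div (k * T)) (cap - length Ls)"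
  have one: "carve_one s T k cap X Ls = groups s T k q Z"
    by (simp add: carve_one_def Let_def Z_def q_def)
  from Cons.prems show ?case
    unfolding process_clusterings_def
    apply (subst wp_While)
    apply (fold process_clusterings_def)
    apply (simp add: encode_clustering_def [of X] one Let_def)
    apply (rule wp_mono [OF read_clustering [where X = X and Y = "[]" and M = "covered Ls"]])
    apply (simp_all flip: Z_def)
    apply (rule wp_mono [OF write_groups [where Z = Z and s = s and T = T and k = k and w = w
            and cap = cap and q = q and W = "concat (map encode_clustering Ls)"
            and M = "covered Ls"]])
    using cap
    apply (simp_all add: unchanged_def flip: q_def)
    apply (rule wp_mono [OF Cons.IH [where Ls = "Ls @ groups s T k q Z"]])
    apply simp_all
    done
qed

text \<open>The target \<open>s\<close> is given by the equivalence that the loop test evaluates. It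
  survives each increment because \<open>share\<close> does not read the counter.\<close>

lemma compute_size:
  assumes "\<And>i. real i < rval \<rho> m share - real (m ''n'' 0) / \<rho> ''k1'' \<longleftrightarrow> i < s"
    and "m ''s'' 0 \<le> s"
  shows "wp \<rho> compute_size (\<lambda>t m'. t \<le> 2 * (s - m ''s'' 0) + 1 \<and> m' = m(''s'' := (m ''s'')(0 := s))) m"
  using assms
proof (induction "s - m ''s'' 0" arbitrary: m)
  case 0
  then show ?case
    unfolding compute_size_def by (subst wp_While) simp
next
  case (Suc d)
  let ?m = "m(''s'' := (m ''s'')(0 := Suc (m ''s'' 0)))"
  have IH: "wp \<rho> compute_size (\<lambda>t m'. t \<le> 2 * (s - ?m ''s'' 0) + 1 \<and> m' = ?m(''s'' := (?m ''s'')(0 := s))) ?m"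
    by (rule Suc.hyps(1)) (use Suc.hyps(2) Suc.prems in \<open>auto simp: share_def\<close>)
  have "real (m ''s'' 0) < rval \<rho> m share - real (m ''n'' 0) / \<rho> ''k1''"
    using Suc by simp
  then show ?case
    unfolding compute_size_def
    apply (subst wp_While)
    apply (fold compute_size_def)
    apply simp
    apply (rule wp_mono [OF IH])
    using Suc
    apply simp_all
    done
qed

lemma compute_stride:
  assumes "\<And>i. rval \<rho> m share < 1 + real i \<longleftrightarrow> T \<le> i"
    and "m ''T'' 0 \<le> T"
  shows "wp \<rho> compute_stride (\<lambda>t m'. t \<le> 2 * (T - m ''T'' 0) + 1 \<and> m' = m(''T'' := (m ''T'')(0 := T))) m"
  using assms
proof (induction "T - m ''T'' 0" arbitrary: m)
  case 0
  then show ?case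
    unfolding compute_stride_def by (subst wp_While) simp
next
  case (Suc d)
  let ?m = "m(''T'' := (m ''T'')(0 := Suc (m ''T'' 0)))"
  have IH: "wp \<rho> compute_stride (\<lambda>t m'. t \<le> 2 * (T - ?m ''T'' 0) + 1 \<and> m' = ?m(''T'' := (?m ''T'')(0 := T))) ?m"
    by (rule Suc.hyps(1)) (use Suc.hyps(2) Suc.prems in \<open>auto simp: share_def\<close>)
  have "\<not> rval \<rho> m share < 1 + real (m ''T'' 0)"
    using Suc by simp
  then show ?case
    unfolding compute_stride_def
    apply (subst wp_While)
    apply (fold compute_stride_def)
    apply simp
    apply (rule wp_mono [OF IH])
    using Suc
    apply simp_all
    done
qed

text \<open>The summand \<open>4 * T\<close> pays for the two counting loops, which take about 2s +
  2T steps with s \<le> T.\<close>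

lemma decompose:
  assumes "m ''in'' 0 = length L" "seg (m ''in'') 1 (concat (map encode_clustering L))"
    and "m ''n'' 0 = n" "m ''k'' 0 = k"
    and "\<And>x. x \<notin> {''in'', ''n'', ''k''} \<Longrightarrow> m x = (\<lambda>_. 0)"
    and "s \<le> T" "0 < k * T"
    and size: "\<And>i. real i < \<rho> ''c'' * n / (length L * k) - n / \<rho> ''k1'' \<longleftrightarrow> i < s"
    and stride: "\<And>i. \<rho> ''c'' * n / (length L * k) < 1 + real i \<longleftrightarrow> T \<le> i"
    and cap: "\<And>j. real (length L) < (1 + real j) * \<rho> ''c'' \<longleftrightarrow> cap \<le> j"
  shows "wp \<rho> decompose
    (\<lambda>t m'. t \<le> 8 * length (concat (map encode_clustering L)) +
             8 * length (concat (map encode_clustering (carve s T k cap L []))) + 4 * T + 8 \<and>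
       seg (m' ''out'') 0 (encode (carve s T k cap L []))) m"
proof -
  let ?m = "m(''w'' := (m ''w'')(0 := length L))"
  have m0: "m x i = 0" if "x \<notin> {''in'', ''n'', ''k''}" for x i
    using assms(5) that by simp
  have w0: "rval \<rho> ?m share = \<rho> ''c'' * n / (length L * k)"
    using assms by (simp add: share_def)
  show ?thesis
    unfolding decompose_def
    apply (simp add: assms(1))
    apply (rule wp_mono [OF compute_size [where s = s]])
      apply (use w0 size assms(1-4) m0 in simp)
     apply (use m0 in simp)
    apply simp
    apply (rule wp_mono [OF compute_stride [where T = T]])
      apply (use stride assms(1-4) m0 in \<open>simp add: share_def\<close>)
     apply (use m0 in simp)
    apply simp
    apply (rule wp_mono [OF process_clusterings [where s = s and T = T and k = k
            and L = L and Ls = "[]" and w = "length L" and cap = cap]])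
    using assms(1-4,6,7) cap m0
    apply (simp_all add: covered_def encode_def)
    done
qed

section \<open>Combinatorics of the groups\<close>

lemma nth_blocks: "i < k \<Longrightarrow> blocks s T k Z ! i = take s (drop (i * T) Z)"
  by (induction k arbitrary: i Z) (auto simp: nth_Cons add.commute split: nat.splits)

lemma blocks_add: "blocks s T (k + l) Z = blocks s T k Z @ blocks s T l (drop (k * T) Z)"
  by (induction k arbitrary: Z) (auto simp: add.commute)

text \<open>Each group drops exactly kT entries, so the next one continues the sequence of blocks at
  the same stride.\<close>

lemma concat_groups: "concat (groups s T k q Z) = blocks s T (q * k) Z"
  by (induction q arbitrary: Z) (auto simp: blocks_add)

lemma set_concat_blocks: "set (concat (blocks s T k Z)) \<subseteq> set Z"
  by (induction k arbitrary: Z) (auto dest: in_set_takeD in_set_dropD)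

lemma distinct_concat_blocks:
  "distinct Z \<Longrightarrow> s \<le> T \<Longrightarrow> distinct (concat (blocks s T k Z))"
proof (induction k arbitrary: Z)
  case (Suc k)
  then have "set (take s Z) \<inter> set (drop T Z) = {}"
    by (simp add: set_take_disj_set_drop_if_distinct)
  then show ?case
    using Suc set_concat_blocks [of s T k "drop T Z"] by auto
qed simp

lemma length_block:
  "B \<in> set (blocks s T k Z) \<Longrightarrow> k * T \<le> length Z \<Longrightarrow> s \<le> T \<Longrightarrow> length B = s"
  by (induction k arbitrary: Z) auto

lemma length_concat_blocks:
  "k * T \<le> length Z \<Longrightarrow> s \<le> T \<Longrightarrow> length (concat (blocks s T k Z)) = k * s"
  by (induction k arbitrary: Z) auto

text \<open>Size and separation of a group depend only on its offset \<open>e\<close> and on having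
  kT entries from there on; its rank among the groups is forgotten.\<close>

lemma in_groups:
  "grp \<in> set (groups s T k q Z) \<Longrightarrow> q * (k * T) \<le> length Z \<Longrightarrow>
     \<exists>e. grp = blocks s T k (drop e Z) \<and> e + k * T \<le> length Z"
proof (induction q arbitrary: Z)
  case (Suc q)
  show ?case
  proof (cases "grp = blocks s T k Z")
    case True
    with Suc.prems show ?thesis by (intro exI [of _ 0]) auto
  next
    case False
    with Suc obtain e where "grp = blocks s T k (drop e (drop (k * T) Z))"
        "e + k * T \<le> length (drop (k * T) Z)"
      by fastforce
    with Suc.prems show ?thesis
      by (intro exI [of _ "e + k * T"]) auto
  qed
qed simp

lemma min_div_mult_le: "min (a div b) c * b \<le> (a::nat)"
  by (metis div_times_less_eq_dividend le_trans min.cobounded1 mult_le_mono1)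

text \<open>The set of covered vertices changes from clustering to clustering, so the filter is
  abstracted to an arbitrary \<open>P\<close>.\<close>

lemma in_carve:
  "grp \<in> set (carve s T k cap L Ls) \<Longrightarrow>
     \<exists>X\<in>set L. \<exists>P e. grp = blocks s T k (drop e (filter P (concat X))) \<and>
       e + k * T \<le> length (filter P (concat X))"
proof (induction L arbitrary: Ls)
  case (Cons X L)
  show ?case
  proof (cases "grp \<in> set (carve_one s T k cap X Ls)")
    case True
    then show ?thesis
      unfolding carve_one_def Let_def
      by (metis in_groups list.set_intros(1) min_div_mult_le)
  next
    case False
    with Cons show ?thesis by (fastforce simp: Let_def)
  qed
qed simp

lemma covered_carve_one: "covered (carve_one s T k cap X Ls) \<subseteq> set (concat X) - covered Ls"
  using set_concat_blocks by (fastforce simp: carve_one_def covered_def concat_groups Let_def)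

text \<open>Each clustering lists only vertices outside all earlier blocks, and blocks cut from one
  list are disjoint because s \<le> T.\<close>

lemma distinct_carve:
  assumes "\<forall>X\<in>set L. distinct (concat X)" "distinct (concat (concat Ls))" "s \<le> T"
  shows "distinct (concat (concat (Ls @ carve s T k cap L Ls)))"
  using assms
proof (induction L arbitrary: Ls)
  case (Cons X L)
  have "distinct (concat (concat (carve_one s T k cap X Ls)))"
    unfolding carve_one_def Let_def concat_groups
    by (rule distinct_concat_blocks) (use Cons.prems in auto)
  with Cons.prems covered_carve_one [of s T k cap X Ls]
  have "distinct (concat (concat (Ls @ carve_one s T k cap X Ls)))"
    by (auto simp: covered_def)
  from Cons.IH [OF _ this] Cons.prems show ?case
    by (simp add: Let_def)
qed simp

lemma length_carve: "length Ls \<le> cap \<Longrightarrow> length (Ls @ carve s T k cap L Ls) \<le> cap"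
proof (induction L arbitrary: Ls)
  case (Cons X L)
  from Cons.prems have "length (Ls @ carve_one s T k cap X Ls) \<le> cap"
    by (auto simp: carve_one_def Let_def)
  from Cons.IH [OF this] show ?case by (simp add: Let_def)
qed simp

section \<open>Losses and input size while the cap is not reached\<close>

context
  fixes s T k cap :: nat and X :: "'a list list" and Ls :: "'a list list list"
  assumes X: "distinct (concat X)" and pos: "0 < k * T" and le: "s \<le> T"
    and below: "length (Ls @ carve_one s T k cap X Ls) < cap"
begin

private abbreviation "Z \<equiv> filter (\<lambda>v. v \<notin> covered Ls) (concat X)"
private abbreviation "q \<equiv> length (carve_one s T k cap X Ls)"

text \<open>If the minimum were the remaining cap, the total number of groups would reach
  \<open>cap\<close>.\<close>

private lemma q_eq: "q = length Z div (k * T)"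
  using below by (simp add: carve_one_def Let_def min_def split: if_splits)

private lemma carve_one_eq: "carve_one s T k cap X Ls = groups s T k (length Z div (k * T)) Z"
  using q_eq by (simp add: carve_one_def Let_def)

private lemma length_Z: "length Z < (q + 1) * (k * T)"
  using pos unfolding q_eq by (metis add.commute dividend_less_times_div mult.commute mult_Suc_right plus_1_eq_Suc)

text \<open>Vertices of \<open>X\<close> outside \<open>Z\<close> are covered already. Of the fewer
  than (q + 1)kT entries of \<open>Z\<close>, exactly qks get covered.\<close>

lemma uncovered_carve_one:
  "card (set (concat X) - covered (Ls @ carve_one s T k cap X Ls)) \<le> k * T + q * (k * (T - s))"
proof -
  have cov: "covered (carve_one s T k cap X Ls) = set (concat (blocks s T (q * k) Z))"
    unfolding q_eq unfolding carve_one_eq by (simp add: covered_def concat_groups)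
  have "card (covered (carve_one s T k cap X Ls)) = q * k * s"
    unfolding cov
    by (subst distinct_card, rule distinct_concat_blocks, use X le in simp, use le in simp,
        rule length_concat_blocks)
       (use le in \<open>simp_all add: q_eq mult.assoc div_times_less_eq_dividend\<close>)
  moreover have "set (concat X) - covered (Ls @ carve_one s T k cap X Ls) =
      set Z - covered (carve_one s T k cap X Ls)"
    by auto
  moreover have "covered (carve_one s T k cap X Ls) \<subseteq> set Z"
    unfolding cov by (rule set_concat_blocks)
  moreover have "card (set Z) = length Z"
    using X by (intro distinct_card distinct_filter)
  ultimately have "card (set (concat X) - covered (Ls @ carve_one s T k cap X Ls)) =
      length Z - q * k * s"
    by (metis List.finite_set card_Diff_subset finite_subset)
  also have "\<dots> \<le> k * T + q * (k * T) - q * k * s"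
    using length_Z by (intro diff_le_mono) simp
  also have "\<dots> \<le> k * T + q * (k * (T - s))"
    using le by (simp add: diff_mult_distrib2 mult.assoc)
  finally show ?thesis .
qed

lemma length_carve_one:
  "length (concat X) \<le> card (covered Ls) + (q + 1) * (k * T)"
proof -
  have "length (concat X) = card (set (concat X))"
    using X by (rule distinct_card [symmetric])
  also have "\<dots> \<le> card (covered Ls \<union> set Z)"
    by (intro card_mono) (auto simp: covered_def)
  also have "\<dots> \<le> card (covered Ls) + card (set Z)"
    by (rule card_Un_le)
  also have "card (set Z) \<le> (q + 1) * (k * T)"
    using length_Z by (meson card_length le_trans less_imp_le_nat)
  finally show ?thesis by simp
qed

end

lemma finite_covered [simp]: "finite (covered Ls)"
  by (simp add: covered_def)

text \<open>A cap missed at the end is missed after every prefix, so the bound for one clustering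
  applies each time and the losses add up.\<close>

lemma uncovered_carve:
  assumes "\<forall>X\<in>set L. distinct (concat X)" "0 < k * T" "s \<le> T"
    and "length (Ls @ carve s T k cap L Ls) < cap"
  shows "card ((\<Union>X\<in>set L. set (concat X)) - covered (Ls @ carve s T k cap L Ls))
    \<le> length L * (k * T) + length (carve s T k cap L Ls) * (k * (T - s))"
  using assms
proof (induction L arbitrary: Ls)
  case (Cons X L)
  let ?N = "carve_one s T k cap X Ls"
  let ?R = "carve s T k cap L (Ls @ ?N)"
  have R: "Ls @ carve s T k cap (X # L) Ls = (Ls @ ?N) @ ?R"
    by (simp add: Let_def)
  have "(\<Union>X\<in>set (X # L). set (concat X)) - covered ((Ls @ ?N) @ ?R) \<subseteq>
      (set (concat X) - covered (Ls @ ?N)) \<union>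
      ((\<Union>X\<in>set L. set (concat X)) - covered ((Ls @ ?N) @ ?R))"
    by auto
  then have "card ((\<Union>X\<in>set (X # L). set (concat X)) - covered ((Ls @ ?N) @ ?R)) \<le>
      card ((set (concat X) - covered (Ls @ ?N)) \<union>
        ((\<Union>X\<in>set L. set (concat X)) - covered ((Ls @ ?N) @ ?R)))"
    by (intro card_mono) auto
  also have "\<dots> \<le> card (set (concat X) - covered (Ls @ ?N)) +
      card ((\<Union>X\<in>set L. set (concat X)) - covered ((Ls @ ?N) @ ?R))"
    by (rule card_Un_le)
  also have "\<dots> \<le> (k * T + length ?N * (k * (T - s))) +
      (length L * (k * T) + length ?R * (k * (T - s)))"
    using Cons.prems
    by (intro add_mono uncovered_carve_one Cons.IH) (simp_all add: Let_def)
  finally show ?case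
    unfolding R by (simp add: Let_def algebra_simps)
qed simp

text \<open>Bounds the size of the input by that of the output. Coverage only grows, so each
  clustering may be charged with the final covered set.\<close>

lemma sum_length_carve:
  assumes "\<forall>X\<in>set L. distinct (concat X)" "0 < k * T" "s \<le> T"
    and "length (Ls @ carve s T k cap L Ls) < cap"
  shows "(\<Sum>X\<leftarrow>L. length (concat X)) \<le> length L * card (covered (Ls @ carve s T k cap L Ls)) +
    (length L + length (carve s T k cap L Ls)) * (k * T)"
  using assms
proof (induction L arbitrary: Ls)
  case (Cons X L)
  let ?N = "carve_one s T k cap X Ls"
  let ?R = "carve s T k cap L (Ls @ ?N)"
  have R: "Ls @ carve s T k cap (X # L) Ls = (Ls @ ?N) @ ?R"
    by (simp add: Let_def)
  have "card (covered Ls) \<le> card (covered ((Ls @ ?N) @ ?R))"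
    by (intro card_mono) auto
  moreover have "length (concat X) \<le> card (covered Ls) + (length ?N + 1) * (k * T)"
    using Cons.prems by (intro length_carve_one) (simp_all add: Let_def)
  moreover have "(\<Sum>X\<leftarrow>L. length (concat X)) \<le> length L * card (covered ((Ls @ ?N) @ ?R)) +
    (length L + length ?R) * (k * T)"
    using Cons.prems by (intro Cons.IH) (simp_all add: Let_def)
  ultimately show ?case
    unfolding R by (simp add: Let_def algebra_simps)
qed simp

section \<open>Separation of the blocks\<close>

text \<open>A cluster is a contiguous stretch of the concatenation, and filtering keeps it
  contiguous and makes it no longer.\<close>

lemma index_diff_less:
  assumes "distinct (concat X)" "x \<in> set X"
    and "i < j" "j < length (filter P (concat X))"
    and "filter P (concat X) ! i \<in> set x" "filter P (concat X) ! j \<in> set x"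
  shows "j - i < length x"
proof -
  obtain A B where X: "X = A @ x # B"
    using assms(2) by (meson split_list)
  define a where "a = filter P (concat A)"
  define y where "y = filter P x"
  define b where "b = filter P (concat B)"
  have Z: "filter P (concat X) = a @ y @ b"
    by (simp add: X a_def y_def b_def)
  have disj: "set a \<inter> set x = {}" "set b \<inter> set x = {}"
    using assms(1) by (auto simp: X a_def b_def)
  \<comment> \<open>\<open>a\<close> and \<open>b\<close> come from other clusters, which are
    disjoint from \<open>x\<close>, so the index must fall into the middle part
    \<open>y\<close>.\<close>
  have range: "length a \<le> l \<and> l < length a + length y"
    if "l < length (a @ y @ b)" "(a @ y @ b) ! l \<in> set x" for l
  proof -
    have "\<not> l < length a"
      using that(2) disj(1) by (auto simp: nth_append disjoint_iff dest: nth_mem)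
    moreover have "l < length a + length y"
    proof (rule ccontr)
      assume l: "\<not> l < length a + length y"
      then have "\<not> l < length a" "\<not> l - length a < length y"
        by auto
      with that have "b ! (l - length a - length y) \<in> set x"
        by (simp only: nth_append if_False)
      moreover have "b ! (l - length a - length y) \<in> set b"
        by (rule nth_mem) (use that(1) l in auto)
      ultimately show False using disj(2) by auto
    qed
    ultimately show ?thesis by simp
  qed
  have "j - i < length y"
    using range [of i] range [of j] assms(3-6) unfolding Z by simp
  also have "length y \<le> length x" by (simp add: y_def)
  finally show ?thesis .
qed

text \<open>Indices in different blocks differ by at least T - s + 1, hence by at least d, whereas
  two vertices of one cluster are less than d apart.\<close>

lemma blocks_in_different_clusters:
  assumes "distinct (concat X)" "x \<in> set X" "length x \<le> d" "s + d \<le> Suc T" "s \<le> T"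
    and len: "e + k * T \<le> length (filter P (concat X))"
    and "A \<in> set (blocks s T k (drop e (filter P (concat X))))"
    and "B \<in> set (blocks s T k (drop e (filter P (concat X))))"
    and "A \<noteq> B" "u \<in> set A" "v \<in> set B"
  shows "\<not> (u \<in> set x \<and> v \<in> set x)"
proof -
  let ?Z = "filter P (concat X)"
  have pos: "\<exists>l. e + i * T \<le> l \<and> l < e + i * T + s \<and> l < length ?Z \<and> ?Z ! l = u"
    if "i < k" "u \<in> set (blocks s T k (drop e ?Z) ! i)" for i u
  proof -
    from that obtain l where l: "l < s" "l < length (drop (i * T) (drop e ?Z))"
        "drop (i * T) (drop e ?Z) ! l = u"
      by (auto simp: nth_blocks in_set_conv_nth)
    then show ?thesis
      by (intro exI [of _ "e + i * T + l"]) (auto simp: ac_simps)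
  qed
  have ordered: False
    if ij: "i < j" "j < k" "u \<in> set (blocks s T k (drop e ?Z) ! i)"
      "v \<in> set (blocks s T k (drop e ?Z) ! j)" "u \<in> set x" "v \<in> set x" for i j u v
  proof -
    obtain l where l: "l < e + i * T + s" "?Z ! l = u"
      using pos [of i u] ij less_trans [of i j k] by auto
    obtain l' where l': "e + j * T \<le> l'" "l' < length ?Z" "?Z ! l' = v"
      using pos [of j v] ij by auto
    have "i * T + T \<le> j * T"
      using ij(1) by (metis Suc_leI mult_Suc add.commute mult_le_mono1)
    \<comment> \<open>The strict bound on \<open>l\<close> supplies the 1 in
      \<open>s + d \<le> Suc T\<close>. The second claim follows from s \<le> T and covers d =
      0.\<close>
    then have "l + d \<le> l'" "l < l'"
      using l l' assms(4,5) by linarith+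
    with index_diff_less [OF assms(1,2), of l l' P] l l' ij assms(3) show False
      by simp
  qed
  obtain i j where "i < k" "j < k" "A = blocks s T k (drop e ?Z) ! i"
      "B = blocks s T k (drop e ?Z) ! j"
    using assms(7,8) by (auto simp: in_set_conv_nth)
  with ordered [of i j u v] ordered [of j i v u] assms(9-11) show ?thesis
    by (metis linorder_neqE_nat)
qed

section \<open>From lists to sets, loads and encoding lengths\<close>

text \<open>Empty lists are excluded because \<open>distinct (concat X)\<close> allows several of
  them, and their sets coincide.\<close>

lemma distinct_map_set:
  "distinct (concat X) \<Longrightarrow> [] \<notin> set X \<Longrightarrow> distinct (map set X) \<and> disjoint (set ` set X)"
proof (induction X)
  case (Cons x X)
  then have disj: "set x \<inter> set y = {}" "set y \<noteq> {}" if "y \<in> set X" for y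
    using that by auto
  then have "set x \<notin> set ` set X" "\<forall>S\<in>set ` set X. S \<inter> set x = {} \<and> set x \<inter> S = {}"
    by fastforce+
  with Cons show ?case
    by (auto simp: disjoint_def)
qed (simp add: disjoint_def)

lemma card_containing_le:
  "(\<Sum>\<S>\<leftarrow>map (\<lambda>X. set ` set X) Ls. card {S\<in>\<S>. v \<in> S})
    \<le> length (filter (\<lambda>x. v \<in> set x) (concat Ls))"
proof (induction Ls)
  case (Cons X Ls)
  have "{S \<in> set ` set X. v \<in> S} = set ` set (filter (\<lambda>x. v \<in> set x) X)"
    by auto
  then have "card {S \<in> set ` set X. v \<in> S} \<le> length (filter (\<lambda>x. v \<in> set x) X)"
    by (metis List.finite_set card_image_le card_length le_trans)
  with Cons show ?case by simp
qed simp

lemma filter_containing_le_1: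
  "distinct (concat X) \<Longrightarrow> length (filter (\<lambda>x. v \<in> set x) X) \<le> 1"
proof (induction X)
  case (Cons x X)
  show ?case
  proof (cases "v \<in> set x")
    case True
    with Cons.prems have "filter (\<lambda>x. v \<in> set x) X = []"
      by (auto simp: filter_empty_conv)
    then show ?thesis by simp
  qed (use Cons in auto)
qed simp

text \<open>Distinct sets admit at most one empty cluster, so there is at most one more cluster than
  there are entries in all clusters.\<close>

lemma length_encode_clustering:
  "distinct (map set X) \<Longrightarrow> length (encode_clustering X) \<le> 2 + 2 * length (concat X)"
proof -
  assume "distinct (map set X)"
  then have X: "distinct X" by (simp add: distinct_map)
  have "length (concat (map encode_cluster X)) = length X + length (concat X)"
    by (induction X) (auto simp: encode_cluster_def)
  moreover have "length X \<le> 1 + length (concat X)"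
  proof -
    have "length (removeAll [] X) \<le> length (concat X)"
    proof (induction X)
      case (Cons x X)
      then show ?case by (cases x) auto
    qed simp
    moreover have "length X \<le> Suc (length (removeAll [] X))"
      using X by (induction X) auto
    ultimately show ?thesis by simp
  qed
  ultimately show ?thesis by (simp add: encode_clustering_def)
qed

section \<open>Correctness and running time\<close>

lemma distinct_concat_if_disjoint:
  "distinct (map set X) \<Longrightarrow> \<forall>x\<in>set X. distinct x \<Longrightarrow> disjoint (set ` set X) \<Longrightarrow> distinct (concat X)"
proof (induction X)
  case (Cons x X)
  have "set x \<inter> set y = {}" if "y \<in> set X" for y
    using Cons.prems(1,3) that by (force simp: disjoint_def)
  moreover have "disjoint (set ` set X)"
    using Cons.prems(3) by (auto simp: disjoint_def)
  ultimately show ?case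
    using Cons by auto
qed simp

text \<open>Finiteness of \<open>\<S>\<close> matters because \<open>card\<close> of an infinite set
  is 0.\<close>

lemma load_ge_1:
  assumes "finite (pverts G)" "v \<in> pverts G" "\<S> \<in> set \<N>" "finite \<S>" "S \<in> \<S>" "v \<in> S"
  shows "1 \<le> load G \<N>"
proof -
  have "1 \<le> card {S \<in> \<S>. v \<in> S}"
    using assms by (auto simp: Suc_le_eq card_gt_0_iff)
  also have "\<dots> \<le> (\<Sum>\<S>\<leftarrow>\<N>. card {S \<in> \<S>. v \<in> S})"
    using assms(3) by (intro member_le_sum_list) auto
  also have "\<dots> \<le> load G \<N>"
    unfolding load_def using assms(1,2) by (intro Max_ge) auto
  finally show ?thesis .
qed

lemma load_le_1:
  assumes "finite (pverts G)" "pverts G \<noteq> {}" "distinct (concat (concat Ls))"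
  shows "load G (map (\<lambda>X. set ` set X) Ls) \<le> 1"
proof -
  have "(\<Sum>\<S>\<leftarrow>map (\<lambda>X. set ` set X) Ls. card {S \<in> \<S>. v \<in> S}) \<le> 1" for v
    using card_containing_le [of v Ls] filter_containing_le_1 [OF assms(3), of v] by linarith
  then show ?thesis
    unfolding load_def using assms(1,2) by (subst Max_le_iff) auto
qed

lemma distinct_concat_member: "distinct (concat (concat Ls)) \<Longrightarrow> X \<in> set Ls \<Longrightarrow> distinct (concat X)"
  by (auto simp: in_set_conv_decomp)

lemma length_concat_concat:
  "\<forall>X\<in>set Ls. length (concat X) = d \<Longrightarrow> length (concat (concat Ls)) = length Ls * d"
  by (induction Ls) auto

lemma length_encode_groups:
  "\<forall>X\<in>set Ls. length X = k \<and> (\<forall>x\<in>set X. length x = s) \<Longrightarrow>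
     length (concat (map encode_clustering Ls)) = length Ls * (1 + k * (1 + s))"
proof (induction Ls)
  case (Cons X Ls)
  have "\<forall>x\<in>set X. length x = s \<Longrightarrow> length (concat (map encode_cluster X)) = length X * (1 + s)"
    by (induction X) (auto simp: encode_cluster_def)
  with Cons show ?case by (simp add: encode_clustering_def)
qed simp

lemma length_encode_clusterings:
  "\<forall>X\<in>set L. distinct (map set X) \<Longrightarrow>
     length (concat (map encode_clustering L)) \<le> 2 * length L + 2 * (\<Sum>X\<leftarrow>L. length (concat X))"
proof (induction L)
  case (Cons X L)
  then show ?case using length_encode_clustering [of X] by simp
qed simp

section \<open>Numerical estimates\<close>

text \<open>The hypothesis on k' gives D \<le> (1 - c')A < A for D = n/k', so A - D is positive.
  Moreover wk \<le> k' \<le> n.\<close>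

lemma block_parameters:
  fixes n w k :: nat and c c' k' :: real
  assumes "1 \<le> w" "1 \<le> k" "0 < c" "c < 1" "0 < c'" "c' < 1"
    and k': "real w * real k / (c * (1 - c')) \<le> k'" and D: "1 \<le> real n / k'"
  defines "A \<equiv> c * real n / (real w * real k)"
  shows "0 < k'" and "1 \<le> \<lceil>A - real n / k'\<rceil>"
    and "nat \<lceil>A - real n / k'\<rceil> + nat \<lfloor>real n / k'\<rfloor> \<le> Suc (nat \<lfloor>A\<rfloor>)"
    and "w * k \<le> n"
proof -
  have wk: "0 < real w * real k" using assms by simp
  have cc: "0 < c * (1 - c')" using assms by simp
  show k'_pos: "0 < k'"
    using k' divide_pos_pos [OF wk cc] by linarith
  have wk_le: "real w * real k \<le> c * (1 - c') * k'"
    using k' cc by (simp add: divide_le_eq mult.commute)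
  have n: "k' \<le> real n" using D k'_pos by (simp add: le_divide_eq)
  have "0 < real n" using n k'_pos by linarith
  then have "real w * real k * real n \<le> c * (1 - c') * k' * real n"
    using wk_le by simp
  then have "real n / k' \<le> (1 - c') * A"
    unfolding A_def using wk k'_pos by (simp add: divide_le_eq le_divide_eq field_simps)
  moreover have "0 < A"
    unfolding A_def using wk assms(3) \<open>0 < real n\<close> by simp
  then have "(1 - c') * A < A"
    using assms(5) by (simp add: algebra_simps)
  ultimately have pos: "0 < A - real n / k'" by linarith
  then show ge: "1 \<le> \<lceil>A - real n / k'\<rceil>" by linarith
  \<comment> \<open>Rounding up adds less than 1 and rounding down adds nothing. The left side is an
    integer below A, hence at most its floor.\<close>
  have "real_of_int (\<lceil>A - real n / k'\<rceil> + \<lfloor>real n / k'\<rfloor> - 1) < A"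
    by linarith
  then have "\<lceil>A - real n / k'\<rceil> + \<lfloor>real n / k'\<rfloor> - 1 \<le> \<lfloor>A\<rfloor>"
    by (simp add: le_floor_iff)
  moreover have "1 \<le> \<lfloor>real n / k'\<rfloor>" using D by simp
  ultimately show "nat \<lceil>A - real n / k'\<rceil> + nat \<lfloor>real n / k'\<rfloor> \<le> Suc (nat \<lfloor>A\<rfloor>)"
    using ge by linarith
  have "c * (1 - c') * k' \<le> 1 * k'"
    using assms k'_pos by (intro mult_right_mono mult_le_one) auto
  with wk_le n have "real (w * k) \<le> real n" by simp
  then show "w * k \<le> n" by linarith
qed

text \<open>T \<le> A gives wkT \<le> cn, and T - s \<le> A - (A - D) = D bounds the gap after each
  block.\<close>

lemma uncovered_bound_below_cap:
  fixes n w k g s T :: nat and c k' :: real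
  assumes "1 \<le> w" "1 \<le> k" "0 < c" "0 < k'" "s \<le> T"
    and T: "real T \<le> c * real n / (real w * real k)"
    and s: "c * real n / (real w * real k) - real n / k' \<le> real s"
    and g: "real g \<le> real w / c"
  shows "real (w * (k * T) + g * (k * (T - s))) \<le> c * real n + real w * real k / (c * k') * real n"
proof -
  have "real w * real k * real T \<le> c * real n"
    using T assms(1,2) by (simp add: le_divide_eq mult_ac)
  moreover have "real g * (real k * (real T - real s)) \<le> real w / c * (real k * (real n / k'))"
    using assms by (intro mult_mono) auto
  ultimately show ?thesis
    using assms(5) by (simp add: of_nat_diff mult_ac)
qed

text \<open>Since (w/c)k(A - D) = n - wkn/(ck'), a fractional number w/c of groups would leave only
  wkn/(ck') vertices. Rounding w/c down loses less than one group, and ks \<le> wkT \<le>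
  cn.\<close>

lemma uncovered_bound_at_cap:
  fixes n w k g s T :: nat and c k' :: real
  assumes "1 \<le> w" "1 \<le> k" "0 < c" "0 < k'" "s \<le> T"
    and T: "real T \<le> c * real n / (real w * real k)"
    and s: "c * real n / (real w * real k) - real n / k' \<le> real s"
    and g: "real w / c < real g + 1"
  shows "real n - real (g * (k * s)) \<le> c * real n + real w * real k / (c * k') * real n"
proof -
  have "real w * (real k * real T) \<le> c * real n"
    using T assms(1,2) by (simp add: le_divide_eq mult_ac)
  moreover have "1 * (real k * real s) \<le> real w * (real k * real T)"
    using assms by (intro mult_mono) auto
  ultimately have ks: "real k * real s \<le> c * real n" by simp
  have "real n - real w * real k / (c * k') * real n =
      real w / c * (real k * (c * real n / (real w * real k) - real n / k'))"
    using assms(1-4) by (simp add: field_simps)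
  also have "\<dots> \<le> real w / c * (real k * real s)"
    using assms by (intro mult_left_mono) auto
  also have "\<dots> \<le> (real g + 1) * (real k * real s)"
    using g by (intro mult_right_mono) auto
  finally show ?thesis
    using ks by (simp add: algebra_simps)
qed

lemma separated_blocks:
  assumes sep: "separated G h (set ` set X)" and X: "distinct (concat X)"
    and d: "\<forall>x\<in>set X. length x \<le> d" "s + d \<le> Suc T" "s \<le> T"
    and grp: "grp = blocks s T k (drop e (filter P (concat X)))"
      "e + k * T \<le> length (filter P (concat X))"
  shows "separated G h (set ` set grp)"
  unfolding separated_def
proof (intro ballI impI)
  fix A B
  assume "A \<in> set ` set grp" "B \<in> set ` set grp" "A \<noteq> B"
  then obtain a b where ab: "a \<in> set grp" "b \<in> set grp" "A = set a" "B = set b" "a \<noteq> b"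
    by auto
  have sub: "set (concat grp) \<subseteq> set (concat X)"
    using set_concat_blocks [of s T k "drop e (filter P (concat X))"]
    unfolding grp(1) by (fastforce dest: in_set_dropD)
  show "ereal h \<le> set_dist G A B"
    unfolding set_dist_def
  proof (intro INF_greatest)
    fix u v assume uv: "u \<in> A" "v \<in> B"
    then have "u \<in> set (concat grp)" "v \<in> set (concat grp)"
      using ab by auto
    then have "u \<in> set (concat X)" "v \<in> set (concat X)"
      using sub by blast+
    then obtain x y where xy: "x \<in> set X" "u \<in> set x" "y \<in> set X" "v \<in> set y"
      by auto
    \<comment> \<open>Since v lies in \<open>y\<close>, this makes the two clusters different, and
      their separation bounds the distance of u and v.\<close>
    have "v \<notin> set x"
      using blocks_in_different_clusters [OF X xy(1) _ d(2,3) grp(2), of a b u v] d(1) xy ab uv grp(1)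
      by auto
    then have "ereal h \<le> set_dist G (set x) (set y)"
      using sep xy unfolding separated_def by blast
    also have "\<dots> \<le> hop_dist G u v"
      unfolding set_dist_def using xy by (meson INF_lower2 order_refl)
    finally show "ereal h \<le> hop_dist G u v" .
  qed
qed

section \<open>Assembly: parameters, time, load and coverage\<close>

theorem theorem4p1:
  "\<exists>(p :: com) (C :: nat).
     \<forall>(n :: nat) (G :: nat pair_pre_digraph) (\<N> :: nat set set list) (L :: nat list list list)
       (w :: nat) (k :: nat) (h_sep :: real) (k' :: real) (c :: real) (c' :: real).
       pair_graph G \<and> pverts G = {..<n} \<and> n \<ge> 1 \<and>
       well_separated_clustering G w h_sep \<N> \<and>
       (\<forall>\<S>\<in>set \<N>. \<forall>S\<in>\<S>. real (card S) \<le> real n / k') \<and>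
       0 < c \<and> c < 1 \<and> 0 < c' \<and> c' < 1 \<and> k \<ge> 1 \<and>
       k' \<ge> real w * real k / (c * (1 - c')) \<and>
       represents L \<N>
       \<longrightarrow>
       (\<exists>t m L' \<G>.
          exec (initial_params c c' k') p (initial_mem n k L) t m \<and>
          t \<le> C * (length \<G> * n) \<and>
          writes_output m L' \<and> represents L' \<G> \<and>
          decomposes_into \<N> \<G> \<and>
          (\<forall>\<B>\<in>set \<G>. disjoint_collection G \<B> \<and> finite \<B> \<and> card \<B> = k \<and> separated G h_sep \<B>) \<and>
          (\<forall>\<B>\<in>set \<G>. \<forall>B\<in>\<B>.
             int (card B) = \<lceil>c * real n / (real w * real k) - real n / k'\<rceil>) \<and>
          \<lceil>c * real n / (real w * real k) - real n / k'\<rceil> \<ge> 1 \<and>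
          real (length \<G>) \<le> real w / c \<and>
          load G \<G> \<le> load G \<N> \<and>
          real (card (uncovered G \<G>))
            \<le> (2 * c + 1 / (c' * k') + real (load G \<G>) * real w * real k / (c * k')) * real n)"
\<comment> \<open>100 = 8 * 8 + 8 * 3 + 4 + 8: in units of gn, input cells are at most 8, output
  cells at most 3, and both T and 1 are at most 1.\<close>
proof (rule exI [of _ decompose], rule exI [of _ 100], intro allI impI, elim conjE)
  fix n :: nat and G :: "nat pair_pre_digraph" and \<N> :: "nat set set list"
    and L :: "nat list list list" and w k :: nat and h_sep k' c c' :: real
  assume G: "pair_graph G" "pverts G = {..<n}" "1 \<le> n"
    and \<N>: "well_separated_clustering G w h_sep \<N>"
    and small: "\<forall>\<S>\<in>set \<N>. \<forall>S\<in>\<S>. real (card S) \<le> real n / k'"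
    and c: "0 < c" "c < 1" and c': "0 < c'" "c' < 1" and k: "1 \<le> k"
    and k': "real w * real k / (c * (1 - c')) \<le> k'"
    and L: "represents L \<N>"
  have \<N>_eq: "\<N> = map (\<lambda>X. set ` set X) L"
    using L by (simp add: represents_def)
  have w: "w = length L"
    using \<N> \<N>_eq by (simp add: well_separated_clustering_def)
  have clustering: "disjoint_collection G (set ` set X)" "separated G h_sep (set ` set X)"
    if "X \<in> set L" for X
    using \<N> that unfolding \<N>_eq well_separated_clustering_def by auto
  have distinct_map_set_L: "\<forall>X\<in>set L. distinct (map set X)"
    using L by (simp add: represents_def)
  have distinct_L: "\<forall>X\<in>set L. distinct (concat X)"
    using L clustering(1) unfolding represents_def disjoint_collection_def
    by (blast intro: distinct_concat_if_disjoint)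
  have vertices: "(\<Union>X\<in>set L. set (concat X)) = {..<n}"
  proof
    show "(\<Union>X\<in>set L. set (concat X)) \<subseteq> {..<n}"
      using clustering(1) unfolding disjoint_collection_def G(2) by auto
    show "{..<n} \<subseteq> (\<Union>X\<in>set L. set (concat X))"
    proof
      fix v assume "v \<in> {..<n}"
      then obtain \<S> S where "\<S> \<in> set \<N>" "S \<in> \<S>" "v \<in> S"
        using \<N> G(2) unfolding well_separated_clustering_def by blast
      then show "v \<in> (\<Union>X\<in>set L. set (concat X))"
        unfolding \<N>_eq by auto
    qed
  qed
  have length_x: "real (length x) \<le> real n / k'" if "X \<in> set L" "x \<in> set X" for X x
  proof -
    have "distinct x" using L that by (auto simp: represents_def)
    moreover have "real (card (set x)) \<le> real n / k'"
      using small that unfolding \<N>_eq by auto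
    ultimately show ?thesis by (simp add: distinct_card)
  qed
  \<comment> \<open>Vertex 0 exists as n \<ge> 1, and its cluster is nonempty. This yields both n/k'
    \<ge> 1 and w \<ge> 1.\<close>
  have "0 \<in> (\<Union>X\<in>set L. set (concat X))"
    unfolding vertices using G(3) by simp
  then obtain X0 x0 where x0: "X0 \<in> set L" "x0 \<in> set X0" "0 \<in> set x0"
    by auto
  then have "1 \<le> length x0" by (cases x0) auto
  with length_x [OF x0(1,2)] have D: "1 \<le> real n / k'" by linarith
  have w1: "1 \<le> w" using x0(1) unfolding w by (cases L) auto

  define A where "A = c * real n / (real w * real k)"
  define s where "s = nat \<lceil>A - real n / k'\<rceil>"
  define T where "T = nat \<lfloor>A\<rfloor>"
  define d where "d = nat \<lfloor>real n / k'\<rfloor>"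
  define cap where "cap = nat \<lfloor>real w / c\<rfloor>"
  note par = block_parameters [OF w1 k c c' k' D, folded A_def]
  note k'_pos = par(1)
  have s_int: "int s = \<lceil>A - real n / k'\<rceil>" and s1: "1 \<le> s"
    using par(2) unfolding s_def by linarith+
  have d1: "1 \<le> d" using D by (simp add: d_def le_nat_floor)
  have sd: "s + d \<le> Suc T" using par(3) by (simp add: s_def d_def T_def)
  with d1 have sT: "s \<le> T" by simp
  have kT: "0 < k * T" using k s1 sT by simp
  have A0: "0 \<le> A" by (simp add: A_def c(1) less_imp_le)
  then have TA: "real T \<le> A" by (simp add: T_def)
  have sA: "A - real n / k' \<le> real s"
    using s_int by linarith
  have wkT: "real (w * (k * T)) \<le> c * real n"
    using TA w1 k by (simp add: A_def le_divide_eq mult_ac)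
  then have wkT_n: "w * (k * T) < n"
    using c G(3) mult_strict_right_mono [of c 1 "real n"] by linarith
  have "real w / c < real cap + 1"
    unfolding cap_def by linarith
  have cap_le: "real cap \<le> real w / c"
    using c by (simp add: cap_def)
  have "1 \<le> real w / c" using w1 c by (simp add: le_divide_eq)
  then have cap1: "1 \<le> cap" by (simp add: cap_def le_nat_floor)
  have cap: "real (length L) < (1 + real j) * c \<longleftrightarrow> cap \<le> j" for j
  proof -
    have "real (length L) < (1 + real j) * c \<longleftrightarrow> real w / c < 1 + real j"
      using c by (simp add: w divide_less_eq)
    also have "\<dots> \<longleftrightarrow> cap \<le> j"
      unfolding cap_def by linarith
    finally show ?thesis .
  qed

  define R where "R = carve s T k cap L []"
  define \<G> where "\<G> = map (\<lambda>X. set ` set X) R"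
  have length_\<G>: "length \<G> = length R" by (simp add: \<G>_def)
  have distinct_R: "distinct (concat (concat R))"
    using distinct_carve [OF distinct_L, of "[]" s T k cap] sT by (simp add: R_def)
  have group: "length grp = k \<and> (\<forall>B\<in>set grp. length B = s) \<and>
      (\<exists>X\<in>set L. set (concat grp) \<subseteq> set (concat X) \<and> separated G h_sep (set ` set grp))"
    if mem: "grp \<in> set R" for grp
  proof -
    obtain X P e where X: "X \<in> set L"
      and grp: "grp = blocks s T k (drop e (filter P (concat X)))"
        "e + k * T \<le> length (filter P (concat X))"
      using in_carve [OF mem [unfolded R_def]] by blast
    have "\<forall>x\<in>set X. length x \<le> d"
      using length_x [OF X] by (simp add: d_def le_nat_floor)
    then have "separated G h_sep (set ` set grp)"
      using separated_blocks [OF clustering(2) [OF X] _ _ sd sT grp] distinct_L X by blast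
    moreover have "set (concat grp) \<subseteq> set (concat X)"
      using set_concat_blocks [of s T k "drop e (filter P (concat X))"]
      unfolding grp(1) by (fastforce dest: in_set_dropD)
    moreover have "\<forall>B\<in>set grp. length B = s"
      using grp sT length_block by (metis add_le_imp_le_diff length_drop add.commute)
    ultimately show ?thesis
      using X grp(1) by auto
  qed
  have length_group: "\<forall>X\<in>set R. length (concat X) = k * s"
  proof
    fix X assume "X \<in> set R"
    with group have "length X = k" "\<forall>B\<in>set X. length B = s" by auto
    moreover have "\<forall>B\<in>set X. length B = s \<Longrightarrow> length (concat X) = length X * s"
      by (induction X) auto
    ultimately show "length (concat X) = k * s" by simp
  qed
  have blocks_ok: "distinct (map set X) \<and> disjoint (set ` set X)" "\<forall>B\<in>set X. distinct B"
    if "X \<in> set R" for X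
  proof -
    have "distinct (concat X)" using distinct_concat_member [OF distinct_R that] .
    \<comment> \<open>Blocks have s \<ge> 1 entries, so distinct blocks remain distinct as
      sets.\<close>
    moreover have "[] \<notin> set X" using group [OF that] s1 by auto
    ultimately show "distinct (map set X) \<and> disjoint (set ` set X)" "\<forall>B\<in>set X. distinct B"
      by (auto simp: distinct_map_set dest: distinct_concat_iff [THEN iffD1])
  qed
  have covered_R: "covered R \<subseteq> {..<n}"
    using group unfolding covered_def vertices [symmetric] by fastforce
  have card_covered: "card (covered R) = length R * (k * s)"
    unfolding covered_def distinct_card [OF distinct_R] by (rule length_concat_concat [OF length_group])
  have uncovered: "uncovered G \<G> = {..<n} - covered R"
    by (auto simp: uncovered_def G(2) \<G>_def covered_def)
  have R_le: "length R \<le> cap"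
    using length_carve [of "[]" cap s T k L] by (simp add: R_def)
  have below: "card ({..<n} - covered R) \<le> w * (k * T) + length R * (k * (T - s))"
      "(\<Sum>X\<leftarrow>L. length (concat X)) \<le> w * (length R * (k * s)) + (w + length R) * (k * T)"
    if "length R < cap"
    using uncovered_carve [OF distinct_L kT sT, of "[]" cap, unfolded vertices] that
      sum_length_carve [OF distinct_L kT sT, of "[]" cap] card_covered
    by (simp_all add: R_def [symmetric] w)
  \<comment> \<open>Without any group all n vertices would be uncovered, but then at most wkT \<le>
    cn < n are. The time bound O(gn) rests on g \<ge> 1.\<close>
  have R1: "1 \<le> length R"
  proof (rule ccontr)
    assume "\<not> 1 \<le> length R"
    then have R: "R = []" by (cases R) auto
    with below(1) cap1 have "n \<le> w * (k * T)" by (simp add: covered_def)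
    with wkT_n show False by simp
  qed
  have g_le: "real (length R) \<le> real w / c"
    using R_le cap_le by linarith
  have "w * 1 \<le> w * k" using k by (intro mult_le_mono) auto
  then have w_n: "w \<le> n" using par(4) by linarith
  have kT_n: "k * T \<le> n"
    using wkT_n mult_le_mono1 [OF w1, of "k * T"] by linarith
  have ks_n: "k * s \<le> n"
    using kT_n sT mult_le_mono2 [OF sT, of k] by linarith

  \<comment> \<open>Below the cap each of the three terms is at most gn, by wkT < n. At the cap w
    \<le> g, and each clustering has at most n vertices.\<close>
  have sum_L: "(\<Sum>X\<leftarrow>L. length (concat X)) \<le> 3 * (length R * n)"
  proof (cases "length R < cap")
    case True
    have "w * (length R * (k * s)) = length R * (w * (k * s))" by simp
    also have "\<dots> \<le> length R * (w * (k * T))"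
      using sT by (intro mult_le_mono2)
    also have "\<dots> \<le> length R * n"
      using wkT_n by (intro mult_le_mono2) simp
    finally have "w * (length R * (k * s)) \<le> length R * n" .
    moreover have "w * (k * T) \<le> length R * n"
      using wkT_n mult_le_mono1 [OF R1, of n] by linarith
    moreover have "length R * (k * T) \<le> length R * n"
      using kT_n by (rule mult_le_mono2)
    ultimately show ?thesis
      using below(2) [OF True] unfolding add_mult_distrib by linarith
  next
    case False
    have "real w \<le> real w / c" using c w1 by (simp add: le_divide_eq)
    also have "\<dots> < real (length R) + 1"
      using False R_le \<open>real w / c < real cap + 1\<close> by simp
    finally have "w \<le> length R" by linarith
    moreover have "length (concat X) \<le> n" if "X \<in> set L" for X
    proof -
      have "length (concat X) = card (set (concat X))"
        using distinct_L that by (intro distinct_card [symmetric]) auto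
      also have "\<dots> \<le> card {..<n}"
        using that unfolding vertices [symmetric] by (intro card_mono) auto
      finally show ?thesis by simp
    qed
    then have "(\<Sum>X\<leftarrow>L. length (concat X)) \<le> (\<Sum>X\<leftarrow>L. n)"
      by (rule sum_list_mono)
    then have "(\<Sum>X\<leftarrow>L. length (concat X)) \<le> w * n"
      by (simp add: w sum_list_triv)
    ultimately show ?thesis
      using mult_le_mono1 [of w "length R" n] by linarith
  qed

  have "wp (initial_params c c' k') decompose
    (\<lambda>t m'. t \<le> 8 * length (concat (map encode_clustering L)) +
             8 * length (concat (map encode_clustering R)) + 4 * T + 8 \<and>
       seg (m' ''out'') 0 (encode R)) (initial_mem n k L)"
    unfolding R_def
  proof (rule decompose [where n = n])
    have enc: "seg (initial_mem n k L ''in'') 0 (encode L)"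
      by (simp add: seg_iff_nth initial_mem_def)
    then show "initial_mem n k L ''in'' 0 = length L"
      "seg (initial_mem n k L ''in'') 1 (concat (map encode_clustering L))"
      by (simp_all add: encode_def)
    show "real i < initial_params c c' k' ''c'' * real n / real (length L * k) -
        real n / initial_params c c' k' ''k1'' \<longleftrightarrow> i < s" for i
      using par(2) by (simp add: initial_params_def s_def A_def w) linarith
    show "initial_params c c' k' ''c'' * real n / real (length L * k) < 1 + real i \<longleftrightarrow> T \<le> i" for i
      using A0 by (simp add: initial_params_def T_def A_def w) linarith
    show "real (length L) < (1 + real j) * initial_params c c' k' ''c'' \<longleftrightarrow> cap \<le> j" for j
      using cap by (simp add: initial_params_def)
  qed (use sT kT in \<open>auto simp: initial_mem_def\<close>)
  then obtain t m where ex: "exec (initial_params c c' k') decompose (initial_mem n k L) t m"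
    and t: "t \<le> 8 * length (concat (map encode_clustering L)) +
             8 * length (concat (map encode_clustering R)) + 4 * T + 8"
    and out: "seg (m ''out'') 0 (encode R)"
    unfolding wp_def by blast
  have time: "t \<le> 100 * (length \<G> * n)"
  proof -
    have n_le: "n \<le> length R * n"
      using mult_le_mono1 [OF R1, of n] by simp
    have "length (concat (map encode_clustering L)) \<le> 8 * (length R * n)"
      using length_encode_clusterings [OF distinct_map_set_L] sum_L w_n n_le w by linarith
    moreover have "length (concat (map encode_clustering R)) \<le> 3 * (length R * n)"
    proof -
      \<comment> \<open>Both 1 and k are at most ks \<le> n, so an encoded group has at most 3n
        cells.\<close>
      have "1 * 1 \<le> k * s" "k * 1 \<le> k * s"
        using k s1 by (intro mult_le_mono; simp)+
      then have "1 + k * (1 + s) \<le> 3 * n"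
        using ks_n unfolding distrib_left by linarith
      then have "length R * (1 + k * (1 + s)) \<le> length R * (3 * n)"
        by (rule mult_le_mono2)
      with group show ?thesis
        by (subst length_encode_groups [of R k s]) (auto simp only: mult.left_commute)
    qed
    moreover have "T \<le> n"
      using kT_n mult_le_mono1 [OF k, of T] by linarith
    ultimately show ?thesis
      using t n_le G(3) unfolding length_\<G> by linarith
  qed

  have load_\<G>_le: "load G \<G> \<le> 1"
    unfolding \<G>_def using distinct_R G(3) by (intro load_le_1) (auto simp: G(2) lessThan_empty_iff)
  have "1 \<le> load G \<N>"
    using x0 G(3) by (intro load_ge_1 [of G 0 "set ` set X0" _ "set x0"]) (auto simp: G(2) \<N>_eq)
  with load_\<G>_le have load_le: "load G \<G> \<le> load G \<N>" by linarith
  \<comment> \<open>The estimate below has no load factor; this inequality inserts it.\<close>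
  have load_\<G>_ge: "1 \<le> load G \<G>"
  proof -
    obtain X where X: "X \<in> set R" using R1 by (cases R) auto
    with group k obtain B where B: "B \<in> set X" by (cases X) fastforce+
    with group [OF X] s1 obtain v where v: "v \<in> set B" by (cases B) fastforce+
    have "v \<in> pverts G"
      using covered_R X B v unfolding G(2) covered_def by auto
    with X B v show ?thesis
      by (intro load_ge_1 [of G v "set ` set X" _ "set B"]) (auto simp: G(2) \<G>_def)
  qed

  have "real (card (uncovered G \<G>)) \<le> c * real n + real w * real k / (c * k') * real n"
  proof (cases "length R < cap")
    case True
    have "real (card (uncovered G \<G>)) \<le> real (w * (k * T) + length R * (k * (T - s)))"
      using below(1) [OF True] unfolding uncovered by linarith
    also have "\<dots> \<le> c * real n + real w * real k / (c * k') * real n"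
      using uncovered_bound_below_cap [OF w1 k c(1) k'_pos sT] TA sA g_le by (simp add: A_def)
    finally show ?thesis .
  next
    case False
    have "card (uncovered G \<G>) = n - length R * (k * s)"
      unfolding uncovered using covered_R card_covered by (simp add: card_Diff_subset)
    moreover have "length R * (k * s) \<le> n"
      using card_mono [OF _ covered_R] card_covered by simp
    ultimately have "real (card (uncovered G \<G>)) = real n - real (length R * (k * s))"
      by (simp add: of_nat_diff)
    also have "\<dots> \<le> c * real n + real w * real k / (c * k') * real n"
      using uncovered_bound_at_cap [OF w1 k c(1) k'_pos sT, of n "length R"] TA sA False R_le
        \<open>real w / c < real cap + 1\<close> by (simp add: A_def)
    finally show ?thesis .
  qed
  also have "\<dots> = (c + 1 * (real w * real k / (c * k'))) * real n"
    by (simp add: distrib_right)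
  also have "\<dots> \<le> (2 * c + 1 / (c' * k') + real (load G \<G>) * (real w * real k / (c * k'))) * real n"
    using c c' k'_pos load_\<G>_ge
    by (intro mult_right_mono add_mono) (auto intro!: add_increasing2)
  finally have uncovered_le: "real (card (uncovered G \<G>))
      \<le> (2 * c + 1 / (c' * k') + real (load G \<G>) * real w * real k / (c * k')) * real n"
    by (simp add: mult.assoc)

  have decomposes: "decomposes_into \<N> \<G>"
  proof -
    have "\<forall>j. \<exists>i. j < length R \<longrightarrow> i < length L \<and> set (concat (R ! j)) \<subseteq> set (concat (L ! i))"
      using group by (metis in_set_conv_nth nth_mem)
    then obtain \<sigma> where \<sigma>: "\<And>j. j < length R \<Longrightarrow>
        \<sigma> j < length L \<and> set (concat (R ! j)) \<subseteq> set (concat (L ! \<sigma> j))"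
      by metis
    \<comment> \<open>All groups are pairwise disjoint, so the second condition of
      \<open>decomposes_into\<close> holds for whichever \<open>\<sigma>\<close> was chosen.\<close>
    have "set (concat (R ! i)) \<inter> set (concat (R ! j)) = {}"
      if "i < j" "j < length R" for i j
    proof -
      have "distinct (concat (concat (take j R @ drop j R)))"
        using distinct_R by simp
      then have "covered (take j R) \<inter> covered (drop j R) = {}"
        by (simp only: concat_append distinct_append covered_def)
      moreover have "R ! i \<in> set (take j R)"
        using that by (auto simp: in_set_conv_nth)
      moreover have "R ! j \<in> set (drop j R)"
        using that by (auto simp: in_set_conv_nth intro!: exI [of _ 0])
      ultimately show ?thesis
        unfolding covered_def by fastforce
    qed
    then have "set (concat (R ! i)) \<inter> set (concat (R ! j)) = {}"
      if "i < length R" "j < length R" "i \<noteq> j" for i j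
      using that by (metis Int_commute linorder_neqE_nat)
    with \<sigma> show ?thesis
      unfolding decomposes_into_def
      by (intro exI [of _ \<sigma>]) (simp add: \<G>_def \<N>_eq)
  qed

  have represents: "represents R \<G>"
    using blocks_ok by (simp add: represents_def \<G>_def)
  have groups_ok: "\<forall>\<B>\<in>set \<G>. disjoint_collection G \<B> \<and> finite \<B> \<and> card \<B> = k \<and> separated G h_sep \<B>"
  proof
    fix \<B> assume "\<B> \<in> set \<G>"
    then obtain X where X: "X \<in> set R" "\<B> = set ` set X" by (auto simp: \<G>_def)
    have "card \<B> = card (set (map set X))" using X by simp
    also have "\<dots> = k"
      using blocks_ok(1) [OF X(1)] group [OF X(1)] by (metis distinct_card length_map)
    finally have "card \<B> = k" .
    moreover have "\<forall>B\<in>\<B>. B \<subseteq> pverts G"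
      using covered_R X unfolding covered_def G(2) by fastforce
    ultimately show "disjoint_collection G \<B> \<and> finite \<B> \<and> card \<B> = k \<and> separated G h_sep \<B>"
      using blocks_ok(1) [OF X(1)] group [OF X(1)] X(2) by (auto simp: disjoint_collection_def)
  qed
  have sizes: "\<forall>\<B>\<in>set \<G>. \<forall>B\<in>\<B>. int (card B) = \<lceil>A - real n / k'\<rceil>"
    using blocks_ok(2) group unfolding s_int [symmetric] by (auto simp: \<G>_def distinct_card)
  have writes: "writes_output m R"
    using out by (simp add: writes_output_def seg_iff_nth)
  show "\<exists>t m L' \<G>.
          exec (initial_params c c' k') decompose (initial_mem n k L) t m \<and>
          t \<le> 100 * (length \<G> * n) \<and>
          writes_output m L' \<and> represents L' \<G> \<and>
          decomposes_into \<N> \<G> \<and>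
          (\<forall>\<B>\<in>set \<G>. disjoint_collection G \<B> \<and> finite \<B> \<and> card \<B> = k \<and> separated G h_sep \<B>) \<and>
          (\<forall>\<B>\<in>set \<G>. \<forall>B\<in>\<B>.
             int (card B) = \<lceil>c * real n / (real w * real k) - real n / k'\<rceil>) \<and>
          \<lceil>c * real n / (real w * real k) - real n / k'\<rceil> \<ge> 1 \<and>
          real (length \<G>) \<le> real w / c \<and>
          load G \<G> \<le> load G \<N> \<and>
          real (card (uncovered G \<G>))
            \<le> (2 * c + 1 / (c' * k') + real (load G \<G>) * real w * real k / (c * k')) * real n"
    using ex time writes represents decomposes groups_ok sizes [unfolded A_def]
      par(2) [unfolded A_def] g_le [folded length_\<G>] load_le uncovered_le
    by (intro exI [of _ t] exI [of _ m] exI [of _ R] exI [of _ \<G>] conjI)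
qed

end
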